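(* Let $A$ and $B$ be any two positive semidefinite complex $n\times n$ matrices, and let $r\ge 0$ and $s\ge 1$ be any real numbers. Then $$\mathrm{Tr}\left(B^r\,(B^{1/2}AB^{1/2})^s\right)\ \ge\ \mathrm{Tr}\left((\Sigma_\uparrow(A))^s\,(\Sigma_\downarrow(B))^{s+r}\right).$$
   Context: Powers of positive semidefinite matrices are defined by the spectral calculus, with $B^0=I$. If $\sigma_1\ge\sigma_2\ge\dots\ge\sigma_n\ge 0$ are the singular values of an $n\times n$ matrix $X$ (the eigenvalues of $|X|=\sqrt{X^*X}$, counted with multiplicity), then $\Sigma_\uparrow(X)=\mathrm{diag}(\sigma_1,\sigma_2,\dots,\sigma_n)$ and $\Sigma_\downarrow(X)=\mathrm{diag}(\sigma_n,\sigma_{n-1},\dots,\sigma_1)$ are the diagonal matrices with the singular values listed in these respective orders down the diagonal. *)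

theory Defs
  imports
    Complex_Main
    "HOL-Library.Multiset"
    "Jordan_Normal_Form.Char_Poly"
    "Jordan_Normal_Form.Schur_Decomposition"
begin

text \<open>The order on complex numbers is the one of \<open>HOL-Library.Complex_Order\<close>:
  \<open>w \<le> z\<close> means that \<open>Re w \<le> Re z\<close> and \<open>Im w = Im z\<close>.  In particular \<open>0 \<le> z\<close> says
  that \<open>z\<close> is real and nonnegative.\<close>

definition unitary_mat :: "complex mat \<Rightarrow> bool" where
  "unitary_mat U \<longleftrightarrow> square_mat U \<and>
     mat_adjoint U * U = 1\<^sub>m (dim_row U) \<and> U * mat_adjoint U = 1\<^sub>m (dim_row U)"

text \<open>The scalar product \<open>x \<bullet>c v\<close> is conjugate-linear in its second argument, so the form
  below is \<open>v\<^sup>* A v\<close>.\<close>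

definition positive_semidefinite :: "complex mat \<Rightarrow> bool" where
  "positive_semidefinite A \<longleftrightarrow> square_mat A \<and> mat_adjoint A = A \<and>
     (\<forall>v \<in> carrier_vec (dim_row A). 0 \<le> (A *\<^sub>v v) \<bullet>c v)"

definition mtrace :: "'a :: comm_monoid_add mat \<Rightarrow> 'a" where
  "mtrace A = (\<Sum>i<dim_row A. A $$ (i, i))"

text \<open>Spectral calculus of a Hermitian matrix: \<open>f(A) = U f(D) U\<^sup>*\<close> for any unitary
  diagonalization \<open>A = U D U\<^sup>*\<close> with real diagonal \<open>D\<close>.  The result does not depend on the
  diagonalization; for a matrix which is not Hermitian the value is unspecified.\<close>

definition spectral_calculus :: "(real \<Rightarrow> real) \<Rightarrow> complex mat \<Rightarrow> complex mat" where
  "spectral_calculus f A = (THE P. \<exists>U d.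
     unitary_mat U \<and> dim_row U = dim_row A \<and>
     A = U * mat_diag (dim_row A) (\<lambda>i. complex_of_real (d i)) * mat_adjoint U \<and>
     P = U * mat_diag (dim_row A) (\<lambda>i. complex_of_real (f (d i))) * mat_adjoint U)"

text \<open>The exponent \<open>0\<close> is treated separately because \<open>0 powr 0 = 0\<close> in Isabelle/HOL, whereas
  \<open>B\<^sup>0 = I\<close> is required also for singular \<open>B\<close>.  For positive exponents \<open>0 powr r = 0\<close>, as it
  should be.\<close>

definition mat_powr :: "complex mat \<Rightarrow> real \<Rightarrow> complex mat" where
  "mat_powr B r = spectral_calculus (\<lambda>x. if r = 0 then 1 else x powr r) B"

definition mat_abs :: "complex mat \<Rightarrow> complex mat" where
  "mat_abs X = mat_powr (mat_adjoint X * X) (1 / 2)"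

text \<open>The eigenvalues of \<open>\<bar>X\<bar>\<close> are the roots of its characteristic polynomial, with
  multiplicity.  They are real and nonnegative, so taking real parts loses nothing.
  The list is in decreasing order and is indexed from \<open>0\<close>:
  \<open>\<sigma>\<^sub>k\<close> is \<open>singular_values X ! (k - 1)\<close>.\<close>

definition singular_values :: "complex mat \<Rightarrow> real list" where
  "singular_values X =
     rev (sorted_list_of_multiset (image_mset Re (proots (char_poly (mat_abs X)))))"

text \<open>The arrow refers to the position of the largest singular value: \<open>Sigma_up\<close> lists the
  singular values in decreasing order down the diagonal, \<open>Sigma_down\<close> in increasing order.\<close>

definition Sigma_up :: "complex mat \<Rightarrow> complex mat" where
  "Sigma_up X = mat_diag (dim_row X) (\<lambda>i. complex_of_real (singular_values X ! i))"

definition Sigma_down :: "complex mat \<Rightarrow> complex mat" where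
  "Sigma_down X = mat_diag (dim_row X) (\<lambda>i. complex_of_real (rev (singular_values X) ! i))"

end

theory Submission
  imports Defs "HOL-Real_Asymp.Real_Asymp"
begin

text \<open>
  Let \<open>a\<close> and \<open>b\<close> be the decreasing sequences of eigenvalues of \<open>A\<close> and \<open>B\<close>, indexed from \<open>0\<close>.
  In an eigenbasis of \<open>B\<close> the matrix \<open>B\<close> is diagonal, and with \<open>C = B^(1/2) A B^(1/2)\<close> the
  inequality says that \<open>\<Sum>i. g i * (C^s) (i, i)\<close> is at least \<open>\<Sum>i. g i * (a (n - 1 - i) * b i)^s\<close>,
  where the weights \<open>g i = (b i)^r\<close> are nonnegative and decreasing.  By summation by parts
  (\<open>sum_mult_mono_of_partial_sums\<close>) it suffices to compare the sums over \<open>i < k\<close> for each \<open>k\<close>,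
  that is, to bound \<open>Tr (P C^s)\<close> from below, \<open>P\<close> being the projection onto the first \<open>k\<close>
  coordinates.

  As \<open>x \<mapsto> x^s\<close> is convex and vanishes at \<open>0\<close>, Jensen's inequality gives
  \<open>Tr (P C^s) \<ge> Tr ((P C P)^s)\<close> (\<open>sum_powr_compression_le\<close>).  Now \<open>P\<close> commutes with \<open>B\<close>, so
  \<open>P C P = (PB)^(1/2) A (PB)^(1/2)\<close> has the same shape as \<open>C\<close>, with the eigenvalues \<open>b i\<close> for
  \<open>i \<ge> k\<close> replaced by \<open>0\<close>.  This reduces everything to the case \<open>r = 0\<close>
  (\<open>sum_powr_eigenvalues_product_ge\<close>): the eigenvalues \<open>z\<close> of \<open>B^(1/2) A B^(1/2)\<close> satisfy
  \<open>\<Sum>i. (z i)^s \<ge> \<Sum>i. (a i * b (n - 1 - i))^s\<close>.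

  For the case \<open>r = 0\<close> one shows for each level \<open>t > 0\<close> that
  \<open>\<Prod>i. max (z i) t \<ge> \<Prod>i. max (a i * b (n - 1 - i)) t\<close>; multiplying the logarithms by
  \<open>t^(s-1)\<close> and integrating over \<open>t\<close> turns this into the claim, because
  \<open>x^s\<close> is \<open>s^2\<close> times the integral of \<open>t^(s-1) ln (max x t / t)\<close> over \<open>t > 0\<close>.  For invertible \<open>B\<close> the
  product inequality is a Lidskii type argument.  Let \<open>M\<close> be obtained from \<open>C\<close> by raising all its
  eigenvalues below \<open>t\<close> to \<open>t\<close>.  Then \<open>N = B^(-1/2) M B^(-1/2)\<close> dominates both \<open>A\<close> and \<open>t B^(-1)\<close>,
  so by monotonicity of eigenvalues its \<open>i\<close>-th eigenvalue is at least \<open>a i\<close> and at least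
  \<open>t / b (n - 1 - i)\<close>.  Multiplying over \<open>i\<close> and using \<open>det N = det M / det B\<close> gives the claim.
  A singular \<open>B\<close>, which the truncation \<open>PB\<close> makes unavoidable, is reached by a perturbation
  (\<open>perturbed_prod_max_bound\<close>).
\<close>

section \<open>Inequalities for real powers\<close>

text \<open>For fixed \<open>x\<close> and \<open>y\<close>, the difference of the values for \<open>y\<close> and for \<open>x\<close> at \<open>t\<close> is the integral
  of \<open>s^2 * u^(s-1) * (ln (max y u) - ln (max x u))\<close> over \<open>u \<ge> t\<close>, and it tends to \<open>y^s - x^s\<close> as \<open>t\<close>
  tends to \<open>0\<close>.\<close>

definition log_primitive :: "real \<Rightarrow> real \<Rightarrow> real \<Rightarrow> real" where
  "log_primitive s x t = max x t powr s - s * t powr s * ln (max x t)"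

lemma log_primitive_has_derivative:
  assumes s: "s > 0" and t: "t > 0"
  shows "(log_primitive s x has_real_derivative - (s\<^sup>2 * t powr (s - 1) * ln (max x t))) (at t)"
proof -
  have below: "((\<lambda>u. x powr s - s * u powr s * ln x) has_real_derivative
      - (s\<^sup>2 * t powr (s - 1) * ln x)) (at t)"
    using t by (auto intro!: derivative_eq_intros simp: powr_diff power2_eq_square)
  have above: "((\<lambda>u. u powr s - s * u powr s * ln u) has_real_derivative
      - (s\<^sup>2 * t powr (s - 1) * ln t)) (at t)"
    using t by (auto intro!: derivative_eq_intros
      simp: powr_diff power2_eq_square field_simps)
  \<comment> \<open>The two formulas agree to first order at \<open>t = x\<close>, so there is no corner.\<close>
  consider "t < x" | "x < t" | "t = x" by linarith
  then show ?thesis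
  proof cases
    case 1
    have "((\<lambda>u. x powr s - s * u powr s * ln x) has_real_derivative
      - (s\<^sup>2 * t powr (s - 1) * ln (max x t))) (at t)"
      using below 1 by simp
    then show ?thesis
      by (rule has_field_derivative_transform_within_open[where S = "{..<x}"])
        (use 1 in \<open>auto simp: log_primitive_def\<close>)
  next
    case 2
    have "((\<lambda>u. u powr s - s * u powr s * ln u) has_real_derivative
      - (s\<^sup>2 * t powr (s - 1) * ln (max x t))) (at t)"
      using above 2 by simp
    then show ?thesis
      by (rule has_field_derivative_transform_within_open[where S = "{x<..}"])
        (use 2 in \<open>auto simp: log_primitive_def max_def\<close>)
  next
    case 3
    let ?D = "- (s\<^sup>2 * t powr (s - 1) * ln (max x t))"
    have "((\<lambda>y. (log_primitive s x y - log_primitive s x t) / (y - t)) \<longlongrightarrow> ?D) (at_left t)"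
    proof (rule Lim_transform_eventually)
      show "((\<lambda>y. ((x powr s - s * y powr s * ln x) - (x powr s - s * t powr s * ln x)) / (y - t))
          \<longlongrightarrow> ?D) (at_left t)"
        using below 3 unfolding has_field_derivative_iff
        by (auto intro: filterlim_at_within_not_equal tendsto_within_subset)
    qed (use 3 in \<open>auto simp: eventually_at_filter log_primitive_def\<close>)
    moreover have "((\<lambda>y. (log_primitive s x y - log_primitive s x t) / (y - t)) \<longlongrightarrow> ?D) (at_right t)"
    proof (rule Lim_transform_eventually)
      show "((\<lambda>y. ((y powr s - s * y powr s * ln y) - (t powr s - s * t powr s * ln t)) / (y - t))
          \<longlongrightarrow> ?D) (at_right t)"
        using above 3 unfolding has_field_derivative_iff
        by (auto intro: filterlim_at_within_not_equal tendsto_within_subset)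
    qed (use 3 in \<open>auto simp: eventually_at_filter log_primitive_def max_def\<close>)
    ultimately show ?thesis
      unfolding has_field_derivative_iff by (simp add: filterlim_at_split)
  qed
qed

lemma log_primitive_tendsto:
  assumes s: "s > 0" and x: "x \<ge> 0"
  shows "(log_primitive s x \<longlongrightarrow> x powr s) (at_right 0)"
proof (cases "x = 0")
  case True
  have "((\<lambda>t. t powr s - s * t powr s * ln t) \<longlongrightarrow> 0) (at_right 0)"
    using s by real_asymp
  then have "(log_primitive s x \<longlongrightarrow> 0) (at_right 0)"
    by (rule Lim_transform_eventually)
      (use True in \<open>auto simp: log_primitive_def eventually_at_filter max_def\<close>)
  then show ?thesis using True by simp
next
  case False
  with x have x: "x > 0" by simp
  have "((\<lambda>t. x powr s - s * t powr s * ln x) \<longlongrightarrow> x powr s) (at_right 0)"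
    using s by real_asymp
  moreover have "eventually (\<lambda>t. x powr s - s * t powr s * ln x = log_primitive s x t) (at_right 0)"
    using eventually_at_right_less x
    unfolding eventually_at_right_field log_primitive_def by (auto intro!: exI[of _ x])
  ultimately show ?thesis by (rule Lim_transform_eventually)
qed

text \<open>The hypothesis is weak majorization of the logarithms, expressed through all truncation levels
  at once, so that neither family has to be sorted.  The difference \<open>F\<close> of the sums of primitives
  is nonincreasing in \<open>t\<close> by hypothesis and vanishes for large \<open>t\<close>; its limit at \<open>0\<close>, which is the
  difference of the sums of powers, is therefore nonnegative.\<close>

lemma sum_powr_le_of_prod_max_le:
  fixes x y :: "nat \<Rightarrow> real"
  assumes s: "s > 0" and x: "\<And>i. i < n \<Longrightarrow> x i \<ge> 0" and y: "\<And>i. i < n \<Longrightarrow> y i \<ge> 0"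
    and le: "\<And>t. t > 0 \<Longrightarrow> (\<Prod>i<n. max (x i) t) \<le> (\<Prod>i<n. max (y i) t)"
  shows "(\<Sum>i<n. x i powr s) \<le> (\<Sum>i<n. y i powr s)"
proof -
  define F where "F t = (\<Sum>i<n. log_primitive s (y i) t - log_primitive s (x i) t)" for t
  define M where "M = 1 + (\<Sum>i<n. x i + y i)"
  have xy_le: "x i \<le> M \<and> y i \<le> M" if "i < n" for i
  proof -
    have "x i + y i \<le> (\<Sum>i<n. x i + y i)"
      by (rule member_le_sum) (use that x y in auto)
    with x[OF that] y[OF that] show ?thesis unfolding M_def by linarith
  qed
  have M: "M > 0" unfolding M_def using x y by (intro add_pos_nonneg sum_nonneg) auto
  have F_M: "F M = 0" unfolding F_def log_primitive_def
    using xy_le by (auto intro!: sum.neutral simp: max_absorb2)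
  have deriv: "\<exists>D. (F has_real_derivative D) (at t) \<and> D \<le> 0" if t: "t > 0" for t
  proof (intro exI conjI)
    show "(F has_real_derivative (\<Sum>i<n. - (s\<^sup>2 * t powr (s - 1) * ln (max (y i) t))
        - - (s\<^sup>2 * t powr (s - 1) * ln (max (x i) t)))) (at t)"
      unfolding F_def by (intro DERIV_sum DERIV_diff log_primitive_has_derivative s t)
    have "(\<Sum>i<n. ln (max (x i) t)) = ln (\<Prod>i<n. max (x i) t)"
      using t by (subst ln_prod) (auto simp: less_max_iff_disj)
    also have "\<dots> \<le> ln (\<Prod>i<n. max (y i) t)"
      using t by (subst ln_le_cancel_iff) (auto intro!: prod_pos le simp: less_max_iff_disj)
    also have "\<dots> = (\<Sum>i<n. ln (max (y i) t))"
      using t by (subst ln_prod) (auto simp: less_max_iff_disj)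
    finally have "s\<^sup>2 * t powr (s - 1) * (\<Sum>i<n. ln (max (x i) t))
        \<le> s\<^sup>2 * t powr (s - 1) * (\<Sum>i<n. ln (max (y i) t))"
      by (rule mult_left_mono) auto
    then show "(\<Sum>i<n. - (s\<^sup>2 * t powr (s - 1) * ln (max (y i) t))
        - - (s\<^sup>2 * t powr (s - 1) * ln (max (x i) t))) \<le> 0"
      by (simp add: sum_distrib_left sum_subtractf)
  qed
  have "F t \<ge> 0" if "t > 0" "t \<le> M" for t
  proof -
    have "F M \<le> F t"
      by (rule DERIV_nonpos_imp_nonincreasing[OF that(2)]) (use deriv that in auto)
    then show ?thesis using F_M by simp
  qed
  then have "eventually (\<lambda>t. 0 \<le> F t) (at_right 0)"
    unfolding eventually_at_right_field using M by (auto intro!: exI[of _ M])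
  moreover have "(F \<longlongrightarrow> (\<Sum>i<n. y i powr s - x i powr s)) (at_right 0)"
    unfolding F_def by (intro tendsto_sum tendsto_diff log_primitive_tendsto s x y) auto
  ultimately have "0 \<le> (\<Sum>i<n. y i powr s - x i powr s)"
    by (intro tendsto_lowerbound) auto
  then show ?thesis by (simp add: sum_subtractf)
qed

text \<open>Summation by parts: writing the decreasing weight \<open>g\<close> as a nonnegative combination of
  indicators of initial segments reduces the weighted sums to partial sums.\<close>

lemma sum_mult_mono_of_partial_sums:
  fixes g p q :: "nat \<Rightarrow> real"
  assumes g_nonneg: "\<And>i. i < n \<Longrightarrow> g i \<ge> 0"
    and g_dec: "\<And>i. Suc i < n \<Longrightarrow> g (Suc i) \<le> g i"
    and partial: "\<And>k. k \<le> n \<Longrightarrow> (\<Sum>i<k. p i) \<le> (\<Sum>i<k. q i)"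
  shows "(\<Sum>i<n. g i * p i) \<le> (\<Sum>i<n. g i * q i)"
proof (cases n)
  case 0 then show ?thesis by simp
next
  case (Suc m)
  define D where "D k = (\<Sum>i<k. q i - p i)" for k
  have D: "D k \<ge> 0" if "k \<le> n" for k
    using partial[OF that] unfolding D_def by (simp add: sum_subtractf)
  \<comment> \<open>The boundary term of the summation by parts is kept in the induction; it is nonnegative.\<close>
  have "k < n \<Longrightarrow> g k * D (Suc k) \<le> (\<Sum>i<Suc k. g i * (q i - p i))" for k
  proof (induction k)
    case 0 then show ?case by (simp add: D_def)
  next
    case (Suc k)
    have "g (Suc k) * D (Suc (Suc k)) = g (Suc k) * D (Suc k) + g (Suc k) * (q (Suc k) - p (Suc k))"
      by (simp add: D_def algebra_simps)
    also have "g (Suc k) * D (Suc k) \<le> g k * D (Suc k)"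
      using Suc.prems by (intro mult_right_mono g_dec D) auto
    finally show ?case using Suc by simp
  qed
  from this[of m] Suc have "g m * D n \<le> (\<Sum>i<n. g i * (q i - p i))" by simp
  moreover have "0 \<le> g m * D n" using D g_nonneg Suc by simp
  ultimately show ?thesis by (simp add: algebra_simps sum_subtractf)
qed

lemma bernoulli_inequality_powr:
  fixes x s :: real
  assumes s: "s \<ge> 1" and x: "x > 0"
  shows "1 + s * (x - 1) \<le> x powr s"
proof -
  have D: "((\<lambda>u. u powr s) has_real_derivative s * u powr (s - 1)) (at u)" if "u > 0" for u
    using that by (auto intro!: derivative_eq_intros)
  consider "x = 1" | "1 < x" | "x < 1" by linarith
  then show ?thesis
  proof cases
    case 2
    obtain u where u: "1 < u" "u < x" "x powr s - 1 powr s = (x - 1) * (s * u powr (s - 1))"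
      using MVT2[OF 2, of "\<lambda>u. u powr s" "\<lambda>u. s * u powr (s - 1)"] D by fastforce
    have "1 powr (s - 1) \<le> u powr (s - 1)"
      by (rule powr_mono2) (use u s in auto)
    then have "(x - 1) * (s * 1) \<le> (x - 1) * (s * u powr (s - 1))"
      using 2 s by (intro mult_left_mono) auto
    then show ?thesis using u by (simp add: algebra_simps)
  next
    case 3
    obtain u where u: "x < u" "u < 1" "1 powr s - x powr s = (1 - x) * (s * u powr (s - 1))"
      using MVT2[OF 3, of "\<lambda>u. u powr s" "\<lambda>u. s * u powr (s - 1)"] D x by fastforce
    have "u powr (s - 1) \<le> 1 powr (s - 1)"
      by (rule powr_mono2) (use u s x in auto)
    then have "(1 - x) * (s * u powr (s - 1)) \<le> (1 - x) * (s * 1)"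
      using 3 s by (intro mult_left_mono) auto
    then show ?thesis using u by (simp add: algebra_simps)
  qed simp
qed

text \<open>Jensen's inequality for \<open>x^s\<close>.  Weights of total mass below \<open>1\<close> are admissible because the
  missing mass can be placed at \<open>0\<close>, where \<open>x^s\<close> vanishes.\<close>

lemma powr_weighted_sum_le:
  fixes w c :: "nat \<Rightarrow> real"
  assumes s: "s \<ge> 1" and w: "\<And>i. i < n \<Longrightarrow> w i \<ge> 0" and c: "\<And>i. i < n \<Longrightarrow> c i \<ge> 0"
    and w1: "(\<Sum>i<n. w i) \<le> 1"
  shows "(\<Sum>i<n. w i * c i) powr s \<le> (\<Sum>i<n. w i * c i powr s)"
proof -
  define m where "m = (\<Sum>i<n. w i * c i)"
  have m0: "m \<ge> 0" unfolding m_def by (intro sum_nonneg) (use w c in auto)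
  show ?thesis
  proof (cases "m = 0")
    case True
    then show ?thesis using w unfolding m_def by (auto intro!: sum_nonneg)
  next
    case False
    with m0 have m: "m > 0" by simp
    \<comment> \<open>Averaging this tangent line bound at the mean \<open>m\<close> gives the inequality.\<close>
    have tangent: "m powr s + s * m powr (s - 1) * (x - m) \<le> x powr s" if "x \<ge> 0" for x
    proof (cases "x = 0")
      case True
      then show ?thesis using m s by (simp add: powr_diff)
    next
      case False
      with that have x: "x > 0" by simp
      have "1 + s * (x / m - 1) \<le> (1 + (x / m - 1)) powr s"
        using bernoulli_inequality_powr[OF s, of "x / m"] x m by simp
      then have "m powr s * (1 + s * (x / m - 1)) \<le> m powr s * (x / m) powr s"
        by (intro mult_left_mono) auto
      then show ?thesis using m x by (simp add: powr_divide powr_diff field_simps)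
    qed
    have "(\<Sum>i<n. w i * (m powr s + s * m powr (s - 1) * (c i - m))) \<le> (\<Sum>i<n. w i * c i powr s)"
      by (intro sum_mono mult_left_mono tangent w c) auto
    moreover have "(\<Sum>i<n. w i * (m powr s + s * m powr (s - 1) * (c i - m)))
       = (\<Sum>i<n. w i) * m powr s + s * m powr (s - 1) * ((\<Sum>i<n. w i * c i) - (\<Sum>i<n. w i) * m)"
      by (simp add: algebra_simps sum.distrib sum_subtractf sum_distrib_left)
    moreover have "s * m powr (s - 1) * ((\<Sum>i<n. w i * c i) - (\<Sum>i<n. w i) * m)
       = s * ((1 - (\<Sum>i<n. w i)) * m powr s)"
      using m unfolding m_def[symmetric] by (simp add: powr_diff algebra_simps)
    moreover have "1 * ((1 - (\<Sum>i<n. w i)) * m powr s) \<le> s * ((1 - (\<Sum>i<n. w i)) * m powr s)"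
      using s w1 by (intro mult_right_mono mult_nonneg_nonneg) auto
    moreover have "m powr s = (\<Sum>i<n. w i) * m powr s + 1 * ((1 - (\<Sum>i<n. w i)) * m powr s)"
      by (simp add: algebra_simps)
    ultimately show ?thesis unfolding m_def[symmetric] by linarith
  qed
qed

section \<open>Adjoints and unitary diagonalizations\<close>

abbreviation rdiag :: "nat \<Rightarrow> (nat \<Rightarrow> real) \<Rightarrow> complex mat" where
  "rdiag n d \<equiv> mat_diag n (\<lambda>i. complex_of_real (d i))"

lemma adjoint_carrier [simp]:
  "A \<in> carrier_mat n m \<Longrightarrow> mat_adjoint A \<in> carrier_mat m n"
  unfolding mat_adjoint_def by (auto simp: mat_of_rows_def)

lemma adjoint_dim [simp]:
  "dim_row (mat_adjoint A) = dim_col A" "dim_col (mat_adjoint A) = dim_row A"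
  unfolding mat_adjoint_def by (auto simp: mat_of_rows_def)

lemma adjoint_index [simp]:
  "i < dim_col A \<Longrightarrow> j < dim_row A \<Longrightarrow> mat_adjoint A $$ (i, j) = conjugate (A $$ (j, i))"
  unfolding mat_adjoint_def by (simp add: mat_of_rows_index)

lemma adjoint_adjoint [simp]:
  fixes A :: "complex mat" shows "mat_adjoint (mat_adjoint A) = A"
  by (rule eq_matI) auto

lemma adjoint_mult:
  fixes A B :: "complex mat"
  assumes "A \<in> carrier_mat n m" "B \<in> carrier_mat m k"
  shows "mat_adjoint (A * B) = mat_adjoint B * mat_adjoint A"
  by (rule eq_matI) (use assms in \<open>auto simp: scalar_prod_def mult.commute intro!: sum.cong\<close>)

lemma adjoint_rdiag [simp]: "mat_adjoint (rdiag n d) = rdiag n d"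
  by (rule eq_matI) (auto simp: mat_diag_def)

lemma adjoint_one [simp]: "mat_adjoint (1\<^sub>m n :: complex mat) = 1\<^sub>m n"
  by (rule eq_matI) auto

lemma cscalar_prod_adjoint:
  fixes A :: "complex mat"
  assumes "A \<in> carrier_mat n m" "x \<in> carrier_vec m" "y \<in> carrier_vec n"
  shows "(A *\<^sub>v x) \<bullet>c y = x \<bullet>c (mat_adjoint A *\<^sub>v y)"
proof -
  have "(A *\<^sub>v x) \<bullet>c y = (\<Sum>i<n. \<Sum>j<m. A $$ (i, j) * x $ j * cnj (y $ i))"
    using assms by (auto simp: scalar_prod_def sum_distrib_right atLeast0LessThan intro!: sum.cong)
  also have "\<dots> = (\<Sum>j<m. \<Sum>i<n. A $$ (i, j) * x $ j * cnj (y $ i))" by (rule sum.swap)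
  also have "\<dots> = x \<bullet>c (mat_adjoint A *\<^sub>v y)"
    using assms
    by (auto simp: scalar_prod_def sum_distrib_left atLeast0LessThan ac_simps intro!: sum.cong)
  finally show ?thesis .
qed

text \<open>Products are normalized to right-nested form; the dimensions are fixed to \<open>n\<close> so that the
  simplifier can discharge the carrier conditions.\<close>

lemmas square_mat_simps = assoc_mult_mat[of _ n n _ n _ n] mult_carrier_mat[of _ n n _ n]
  adjoint_mult[of _ n n _ n] right_mult_one_mat[of _ n n] left_mult_one_mat[of _ n n]
  mult_mat_vec_carrier[of _ n n] for n

definition diagonalizes :: "nat \<Rightarrow> complex mat \<Rightarrow> (nat \<Rightarrow> real) \<Rightarrow> complex mat \<Rightarrow> bool" where
  "diagonalizes n U d A \<longleftrightarrow> U \<in> carrier_mat n n \<and> mat_adjoint U * U = 1\<^sub>m n \<and>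
     U * mat_adjoint U = 1\<^sub>m n \<and> A = U * rdiag n d * mat_adjoint U"

lemma diagonalizesD:
  assumes "diagonalizes n U d A"
  shows "U \<in> carrier_mat n n" "mat_adjoint U * U = 1\<^sub>m n" "U * mat_adjoint U = 1\<^sub>m n"
    "A = U * rdiag n d * mat_adjoint U" "A \<in> carrier_mat n n" "mat_adjoint U \<in> carrier_mat n n"
    "mat_adjoint A = A"
proof -
  show U: "U \<in> carrier_mat n n" and 1: "mat_adjoint U * U = 1\<^sub>m n" "U * mat_adjoint U = 1\<^sub>m n"
    and A: "A = U * rdiag n d * mat_adjoint U"
    using assms by (auto simp: diagonalizes_def)
  show U': "mat_adjoint U \<in> carrier_mat n n" using U by simp
  show "A \<in> carrier_mat n n" unfolding A using U by (intro mult_carrier_mat[of _ n n] U U') auto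
  show "mat_adjoint A = A" unfolding A
    using U U' by (simp add: square_mat_simps[where n=n])
qed

text \<open>The cancellation law in the form needed for right-nested products.\<close>

lemma left_unitary_cancel:
  assumes "X * Y = 1\<^sub>m n" "X \<in> carrier_mat n n" "Y \<in> carrier_mat n n" "B \<in> carrier_mat n n"
  shows "X * (Y * B) = (B :: complex mat)"
  using assms by (simp flip: assoc_mult_mat[of X n n Y n B n])

text \<open>Independence of the spectral calculus from the diagonalization: the transition matrix
  \<open>W = V^* U\<close> intertwines the two diagonal matrices, so \<open>W (i, j) \<noteq> 0\<close> forces \<open>e i = d j\<close>, and
  \<open>W\<close> intertwines the images under \<open>f\<close> as well.\<close>

lemma diagonal_function_transfer:
  assumes U: "diagonalizes n U d A" and V: "diagonalizes n V e A"
  shows "U * rdiag n (\<lambda>i. f (d i)) * mat_adjoint U = V * rdiag n (\<lambda>i. f (e i)) * mat_adjoint V"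
proof -
  note u = diagonalizesD[OF U] and v = diagonalizesD[OF V]
  note [simp] = u(1,6) v(1,6) square_mat_simps[where n=n] u(2,3) v(2,3)
    left_unitary_cancel[OF u(2)] left_unitary_cancel[OF u(3)]
    left_unitary_cancel[OF v(2)] left_unitary_cancel[OF v(3)]
  define W where "W = mat_adjoint V * U"
  have W: "W \<in> carrier_mat n n" unfolding W_def by simp
  have "mat_adjoint V * (A * U) = W * rdiag n d" unfolding W_def by (subst u(4)) simp
  moreover have "mat_adjoint V * (A * U) = rdiag n e * W" unfolding W_def by (subst v(4)) simp
  ultimately have com: "W * rdiag n d = rdiag n e * W" by simp
  have "W $$ (i, j) * f (d j) = f (e i) * W $$ (i, j)" if ij: "i < n" "j < n" for i j
  proof -
    have "(W * rdiag n d) $$ (i, j) = (rdiag n e * W) $$ (i, j)" using com by simp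
    then have "W $$ (i, j) * d j = e i * W $$ (i, j)"
      using ij by (simp add: mat_diag_mult_right[OF W] mat_diag_mult_left[OF W])
    then have "W $$ (i, j) = 0 \<or> d j = e i" by auto
    then show ?thesis by auto
  qed
  then have "W * rdiag n (\<lambda>i. f (d i)) = rdiag n (\<lambda>i. f (e i)) * W"
    by (intro eq_matI) (auto simp: mat_diag_mult_right[OF W] mat_diag_mult_left[OF W])
  then have "V * (W * rdiag n (\<lambda>i. f (d i))) * mat_adjoint U
      = V * (rdiag n (\<lambda>i. f (e i)) * W) * mat_adjoint U" by simp
  then show ?thesis unfolding W_def by simp
qed

lemma spectral_calculus_eq:
  assumes U: "diagonalizes n U d A"
  shows "spectral_calculus f A = U * rdiag n (\<lambda>i. f (d i)) * mat_adjoint U"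
  unfolding spectral_calculus_def
proof (rule the_equality)
  note u = diagonalizesD[OF U]
  have dim: "dim_row A = n" "dim_row U = n" "square_mat U" using u by auto
  show "\<exists>U' d'. unitary_mat U' \<and> dim_row U' = dim_row A \<and>
     A = U' * rdiag (dim_row A) d' * mat_adjoint U' \<and>
     U * rdiag n (\<lambda>i. f (d i)) * mat_adjoint U
       = U' * rdiag (dim_row A) (\<lambda>i. f (d' i)) * mat_adjoint U'"
    using u dim by (intro exI[of _ U] exI[of _ d]) (auto simp: unitary_mat_def)
next
  fix P
  assume "\<exists>V e. unitary_mat V \<and> dim_row V = dim_row A \<and>
     A = V * rdiag (dim_row A) e * mat_adjoint V \<and>
     P = V * rdiag (dim_row A) (\<lambda>i. f (e i)) * mat_adjoint V"
  then obtain V e where V: "unitary_mat V" "dim_row V = dim_row A"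
     "A = V * rdiag (dim_row A) e * mat_adjoint V"
     "P = V * rdiag (dim_row A) (\<lambda>i. f (e i)) * mat_adjoint V" by blast
  have n: "dim_row A = n" using diagonalizesD(5)[OF U] by auto
  have "diagonalizes n V e A"
    using V n by (auto simp: diagonalizes_def unitary_mat_def intro!: carrier_matI)
  from diagonal_function_transfer[OF U this, of f] V n
  show "P = U * rdiag n (\<lambda>i. f (d i)) * mat_adjoint U" by simp
qed

lemma diagonalizes_spectral_calculus:
  assumes U: "diagonalizes n U d A"
  shows "diagonalizes n U (\<lambda>i. f (d i)) (spectral_calculus f A)"
  using spectral_calculus_eq[OF U] diagonalizesD[OF U] by (auto simp: diagonalizes_def)

lemma diagonalizes_mat_powr:
  assumes U: "diagonalizes n U d A"
  shows "diagonalizes n U (\<lambda>i. if r = 0 then 1 else d i powr r) (mat_powr A r)"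
  unfolding mat_powr_def using diagonalizes_spectral_calculus[OF U] .

lemma diagonalizes_rdiag: "diagonalizes n (1\<^sub>m n) d (rdiag n d)"
  by (auto simp: diagonalizes_def right_mult_one_mat[of _ n n] left_mult_one_mat[of _ n n])

lemma mat_powr_rdiag: "mat_powr (rdiag n d) r = rdiag n (\<lambda>i. if r = 0 then 1 else d i powr r)"
  using diagonalizesD(4)[OF diagonalizes_mat_powr[OF diagonalizes_rdiag[of n d], of r]]
  by (simp add: square_mat_simps[where n=n])

lemma char_poly_diagonalizes:
  assumes U: "diagonalizes n U d A"
  shows "char_poly A = (\<Prod>a\<leftarrow>map (\<lambda>i. complex_of_real (d i)) [0..<n]. [:- a, 1:])"
proof -
  note u = diagonalizesD[OF U]
  have "similar_mat_wit A (rdiag n d) U (mat_adjoint U)"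
    using u by (intro similar_mat_witI[of _ _ n]) auto
  then have "char_poly A = char_poly (rdiag n d)"
    by (intro char_poly_similar) (auto simp: similar_mat_def)
  also have "\<dots> = (\<Prod>a\<leftarrow>diag_mat (rdiag n d). [:- a, 1:])"
    by (rule char_poly_upper_triangular[of _ n]) (auto simp: mat_diag_def)
  also have "diag_mat (rdiag n d) = map (\<lambda>i. complex_of_real (d i)) [0..<n]"
    by (auto simp: diag_mat_def mat_diag_def)
  finally show ?thesis .
qed

lemma det_diagonalizes:
  assumes U: "diagonalizes n U d A"
  shows "det A = complex_of_real (\<Prod>i<n. d i)"
proof -
  note u = diagonalizesD[OF U]
  have "similar_mat_wit A (rdiag n d) U (mat_adjoint U)"
    using u by (intro similar_mat_witI[of _ _ n]) auto
  then have "det A = det (rdiag n d)"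
    by (intro det_similar) (auto simp: similar_mat_def)
  also have "\<dots> = prod_list (diag_mat (rdiag n d))"
    by (rule det_upper_triangular[of _ n]) (auto simp: mat_diag_def)
  also have "diag_mat (rdiag n d) = map (\<lambda>i. complex_of_real (d i)) [0..<n]"
    by (auto simp: diag_mat_def mat_diag_def)
  finally show ?thesis by (simp add: prod.list_conv_set_nth lessThan_atLeast0)
qed

section \<open>Quadratic forms\<close>

definition qform :: "complex mat \<Rightarrow> complex vec \<Rightarrow> real" where
  "qform A x = Re ((A *\<^sub>v x) \<bullet>c x)"

definition sqnorm :: "complex vec \<Rightarrow> real" where
  "sqnorm x = (\<Sum>i<dim_vec x. (cmod (x $ i))\<^sup>2)"

lemma qform_conj:
  assumes "S \<in> carrier_mat n m" "A \<in> carrier_mat m m" "x \<in> carrier_vec n"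
  shows "qform (S * A * mat_adjoint S) x = qform A (mat_adjoint S *\<^sub>v x)"
proof -
  have "S * A * mat_adjoint S *\<^sub>v x = S *\<^sub>v (A *\<^sub>v (mat_adjoint S *\<^sub>v x))"
    using assms by (simp add: assoc_mult_mat_vec[of _ n m _ n] assoc_mult_mat_vec[of _ n m _ m] mult_mat_vec_carrier[of _ m n])
  then show ?thesis unfolding qform_def
    using assms by (simp add: cscalar_prod_adjoint[of S n m] mult_mat_vec_carrier[of A m m] mult_mat_vec_carrier[of _ m n])
qed

lemma qform_rdiag:
  assumes "x \<in> carrier_vec n"
  shows "qform (rdiag n d) x = (\<Sum>i<n. d i * (cmod (x $ i))\<^sup>2)"
proof -
  have "(rdiag n d *\<^sub>v x) $ i = d i * x $ i" if "i < n" for i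
    using that assms by (simp add: mat_diag_def scalar_prod_def if_distrib[of "\<lambda>a. a * _"] sum.delta cong: if_cong)
  then have "(rdiag n d *\<^sub>v x) \<bullet>c x = (\<Sum>i<n. d i * x $ i * cnj (x $ i))"
    using assms by (simp add: scalar_prod_def atLeast0LessThan)
  also have "\<dots> = complex_of_real (\<Sum>i<n. d i * (cmod (x $ i))\<^sup>2)"
    by (simp add: mult.assoc complex_norm_square[symmetric])
  finally show ?thesis unfolding qform_def by simp
qed

lemma qform_one:
  assumes "x \<in> carrier_vec n" shows "qform (1\<^sub>m n) x = sqnorm x"
  using qform_rdiag[OF assms, of "\<lambda>_. 1"] assms by (simp add: sqnorm_def)

lemma qform_diagonalizes:
  assumes U: "diagonalizes n U d A" and x: "x \<in> carrier_vec n"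
  shows "qform A x = (\<Sum>i<n. d i * (cmod ((mat_adjoint U *\<^sub>v x) $ i))\<^sup>2)"
proof -
  note u = diagonalizesD[OF U]
  have "qform A x = qform (rdiag n d) (mat_adjoint U *\<^sub>v x)"
    unfolding u(4) using u x by (intro qform_conj) auto
  also have "\<dots> = (\<Sum>i<n. d i * (cmod ((mat_adjoint U *\<^sub>v x) $ i))\<^sup>2)"
    using u x by (intro qform_rdiag mult_mat_vec_carrier[of _ n n]) auto
  finally show ?thesis .
qed

lemma sqnorm_unitary:
  assumes U: "U \<in> carrier_mat n n" "U * mat_adjoint U = 1\<^sub>m n" and x: "x \<in> carrier_vec n"
  shows "sqnorm (mat_adjoint U *\<^sub>v x) = sqnorm x"
proof -
  have "sqnorm (mat_adjoint U *\<^sub>v x) = qform (1\<^sub>m n) (mat_adjoint U *\<^sub>v x)"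
    using U x by (intro qform_one[symmetric] mult_mat_vec_carrier[of _ n n]) auto
  also have "\<dots> = qform (U * 1\<^sub>m n * mat_adjoint U) x"
    using U x by (intro qform_conj[symmetric]) auto
  also have "\<dots> = sqnorm x" using U x by (simp add: qform_one)
  finally show ?thesis .
qed

section \<open>The spectral theorem\<close>

lemma mult_mat_index_sum:
  assumes "A \<in> carrier_mat n m" "B \<in> carrier_mat m k" "i < n" "j < k"
  shows "(A * B) $$ (i, j) = (\<Sum>l<m. A $$ (i, l) * B $$ (l, j))"
  using assms by (simp add: scalar_prod_def atLeast0LessThan)

lemma mat_diag_Suc:
  "mat_diag (Suc m) (\<lambda>i. (e # es) ! i) =
     four_block_mat (mat_diag 1 (\<lambda>_. e)) (0\<^sub>m 1 m) (0\<^sub>m m 1) (mat_diag m (\<lambda>i. es ! i))"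
  by (rule eq_matI) (auto simp: mat_diag_def nth_Cons')

lemma block_diag_mult:
  fixes A A' B B' :: "complex mat"
  assumes "A \<in> carrier_mat k k" "A' \<in> carrier_mat k k" "B \<in> carrier_mat m m" "B' \<in> carrier_mat m m"
  shows "four_block_mat A (0\<^sub>m k m) (0\<^sub>m m k) B * four_block_mat A' (0\<^sub>m k m) (0\<^sub>m m k) B'
    = four_block_mat (A * A') (0\<^sub>m k m) (0\<^sub>m m k) (B * B')"
  using assms mult_carrier_mat[OF assms(1,2)] mult_carrier_mat[OF assms(3,4)]
  by (subst mult_four_block_mat[of _ k k _ m _ m _ _ k _ m]) auto

text \<open>An eigenvector is completed to a basis, orthogonalized by Gram--Schmidt, and the resulting
  vectors are normalized.\<close>

lemma orthonormal_columns_of_eigenvector: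
  fixes A :: "complex mat"
  assumes A: "A \<in> carrier_mat n n" and e: "eigenvalue A e" and n: "n > 0"
  obtains W where "W \<in> carrier_mat n n" "mat_adjoint W * W = 1\<^sub>m n" "W * mat_adjoint W = 1\<^sub>m n"
    "\<And>i. i < n \<Longrightarrow> (A * W) $$ (i, 0) = e * W $$ (i, 0)"
proof -
  define v where "v = find_eigenvector A e"
  have ev: "eigenvector A v e" using find_eigenvector[OF A e] unfolding v_def .
  then have v: "v \<in> carrier_vec n" and v0: "v \<noteq> 0\<^sub>v n" and Av: "A *\<^sub>v v = e \<cdot>\<^sub>v v"
    using A by (auto simp: eigenvector_def)
  define b where "b = basis_completion v"
  define ws where "ws = gram_schmidt n b"
  interpret cof_vec_space n "TYPE(complex)" .
  from basis_completion[OF v v0, folded b_def]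
  have dist_b: "distinct b" and indep: "\<not> lin_dep (set b)" and b: "set b \<subseteq> carrier_vec n"
    and hdb: "hd b = v" and len_b: "length b = n" by auto
  from hdb len_b n obtain vs where bv: "b = v # vs" by (cases b) auto
  from gram_schmidt_result[OF b dist_b indep refl, folded ws_def]
  have ws: "set ws \<subseteq> carrier_vec n" "corthogonal ws" "length ws = n"
    by (auto simp: len_b)
  have "hd ws = v" using gram_schmidt_hd[OF v, of vs, folded bv] unfolding ws_def .
  then have ws0: "ws ! 0 = v" using ws n by (cases ws) auto
  have wsi: "ws ! i \<in> carrier_vec n" if "i < n" for i using ws that by auto
  define c where "c i = complex_of_real (sqrt (sqnorm (ws ! i)))" for i
  have self: "ws ! i \<bullet>c ws ! i = complex_of_real (sqnorm (ws ! i))" if "i < n" for i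
    using wsi[OF that]
    by (simp add: sqnorm_def scalar_prod_def atLeast0LessThan flip: complex_norm_square)
  have "ws ! i \<bullet>c ws ! i \<noteq> 0" if "i < n" for i
    using corthogonalD[OF ws(2), of i i] that ws(3) by simp
  then have pos: "sqnorm (ws ! i) \<noteq> 0" if "i < n" for i using self that by fastforce
  have nonneg: "sqnorm x \<ge> 0" for x unfolding sqnorm_def by (intro sum_nonneg) auto
  have cc: "cnj (c i) * c i = complex_of_real (sqnorm (ws ! i))" "cnj (c i) = c i" for i
    using nonneg unfolding c_def by (simp_all flip: of_real_mult)
  define W where "W = Matrix.mat n n (\<lambda>(i, j). ws ! j $ i / c j)"
  have W: "W \<in> carrier_mat n n" unfolding W_def by simp
  have "(mat_adjoint W * W) $$ (i, j) = (1\<^sub>m n :: complex mat) $$ (i, j)" if ij: "i < n" "j < n" for i j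
  proof -
    have "(mat_adjoint W * W) $$ (i, j) = (\<Sum>k<n. cnj (ws ! i $ k / c i) * (ws ! j $ k / c j))"
      using ij W by (simp add: scalar_prod_def atLeast0LessThan) (simp add: W_def)
    also have "\<dots> = (\<Sum>k<n. ws ! j $ k * cnj (ws ! i $ k)) / (cnj (c i) * c j)"
      by (simp add: sum_divide_distrib field_simps)
    also have "(\<Sum>k<n. ws ! j $ k * cnj (ws ! i $ k)) = ws ! j \<bullet>c ws ! i"
      using wsi[OF ij(1)] wsi[OF ij(2)] by (simp add: scalar_prod_def atLeast0LessThan)
    finally have *: "(mat_adjoint W * W) $$ (i, j) = (ws ! j \<bullet>c ws ! i) / (cnj (c i) * c j)" .
    show ?thesis
    proof (cases "i = j")
      case True
      then show ?thesis using * ij pos cc(1) self by simp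
    next
      case False
      then show ?thesis using * ij corthogonalD[OF ws(2), of j i] ws(3) by simp
    qed
  qed
  then have 1: "mat_adjoint W * W = 1\<^sub>m n" using W by (intro eq_matI) auto
  then have 2: "W * mat_adjoint W = 1\<^sub>m n"
    using W by (intro mat_mult_left_right_inverse[of "mat_adjoint W"]) auto
  have "(A * W) $$ (i, 0) = e * W $$ (i, 0)" if i: "i < n" for i
  proof -
    have "(A * W) $$ (i, 0) = (\<Sum>k<n. A $$ (i, k) * (v $ k / c 0))"
      using A W i n by (simp add: scalar_prod_def atLeast0LessThan) (simp add: W_def ws0)
    also have "\<dots> = (A *\<^sub>v v) $ i / c 0"
      using A v i by (simp add: scalar_prod_def atLeast0LessThan sum_divide_distrib)
    also have "\<dots> = e * W $$ (i, 0)" using Av v i n by (simp add: W_def ws0)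
    finally show ?thesis .
  qed
  from that[OF W 1 2 this] show ?thesis .
qed

text \<open>Deflation: conjugation by a unitary matrix whose first column is an eigenvector makes the
  first column a multiple of the first unit vector; for a Hermitian matrix the first row follows
  suit, and the induction hypothesis applies to the remaining block.  Prescribing the list of roots
  of the characteristic polynomial gives control over the order of the eigenvalues.\<close>

lemma hermitian_diagonalization_with_spectrum:
  fixes A :: "complex mat"
  assumes "A \<in> carrier_mat n n" "mat_adjoint A = A" "char_poly A = (\<Prod>e\<leftarrow>es. [:- e, 1:])"
  shows "\<exists>U. U \<in> carrier_mat n n \<and> mat_adjoint U * U = 1\<^sub>m n \<and> U * mat_adjoint U = 1\<^sub>m n \<and>
    A = U * mat_diag n (\<lambda>i. es ! i) * mat_adjoint U"
  using assms
proof (induction es arbitrary: n A)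
  case Nil
  with degree_monic_char_poly[of A n] have "n = 0" by simp
  with Nil show ?case by (intro exI[of _ "1\<^sub>m 0"]) auto
next
  case (Cons e es n A)
  note A = Cons.prems(1) and herm = Cons.prems(2)
  let ?cp = "char_poly A"
  have cp: "?cp = [: -e, 1 :] * (\<Prod>e \<leftarrow> es. [:- e, 1:])" using Cons.prems(3) by simp
  have mon: "monic (\<Prod>e\<leftarrow> es. [:- e, 1:])" by (rule monic_prod_list) auto
  have deg: "degree ?cp = Suc (degree (\<Prod>e\<leftarrow> es. [:- e, 1:]))" unfolding cp
    by (subst degree_mult_eq) (use mon in auto)
  with degree_monic_char_poly[OF A] have n: "n > 0" by auto
  then obtain m where m: "n = Suc m" by (cases n) auto
  have e: "eigenvalue A e" unfolding eigenvalue_root_char_poly[OF A] cp by simp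
  obtain W where W: "W \<in> carrier_mat n n" and WW: "mat_adjoint W * W = 1\<^sub>m n" "W * mat_adjoint W = 1\<^sub>m n"
    and AW: "\<And>i. i < n \<Longrightarrow> (A * W) $$ (i, 0) = e * W $$ (i, 0)"
    using orthonormal_columns_of_eigenvector[OF A e n] by blast
  have W': "mat_adjoint W \<in> carrier_mat n n" using W by simp
  note [simp] = A W W' square_mat_simps[where n=n] WW left_unitary_cancel[OF WW(1)] left_unitary_cancel[OF WW(2)]
  define A' where "A' = mat_adjoint W * A * W"
  have A': "A' \<in> carrier_mat n n" unfolding A'_def by simp
  have herm': "mat_adjoint A' = A'"
    unfolding A'_def by (simp add: herm)
  have col0: "A' $$ (i, 0) = (if i = 0 then e else 0)" if i: "i < n" for i
  proof -
    have "A' $$ (i, 0) = (mat_adjoint W * (A * W)) $$ (i, 0)" unfolding A'_def by simp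
    also have "\<dots> = (\<Sum>k<n. mat_adjoint W $$ (i, k) * (A * W) $$ (k, 0))"
      using i n by (intro mult_mat_index_sum[of _ n n _ n]) auto
    also have "\<dots> = e * (\<Sum>k<n. mat_adjoint W $$ (i, k) * W $$ (k, 0))"
      by (simp add: AW sum_distrib_left ac_simps del: adjoint_index index_mult_mat(1))
    also have "(\<Sum>k<n. mat_adjoint W $$ (i, k) * W $$ (k, 0)) = (mat_adjoint W * W) $$ (i, 0)"
      using i n by (intro mult_mat_index_sum[of _ n n _ n, symmetric]) auto
    finally show ?thesis using i n by simp
  qed
  have row0: "A' $$ (0, j) = (if j = 0 then e else 0)" if j: "j < n" for j
  proof -
    have "A' $$ (0, j) = mat_adjoint A' $$ (0, j)" using herm' by simp
    also have "\<dots> = cnj (A' $$ (j, 0))" using j n A' by simp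
    also have "\<dots> = (if j = 0 then cnj e else 0)" using col0[OF j] by simp
    finally have *: "A' $$ (0, j) = (if j = 0 then cnj e else 0)" .
    then show ?thesis using col0[OF j] by auto
  qed
  define A3 where "A3 = Matrix.mat m m (\<lambda>(i, j). A' $$ (Suc i, Suc j))"
  have A3: "A3 \<in> carrier_mat m m" unfolding A3_def by simp
  have A3h: "mat_adjoint A3 = A3"
  proof (rule eq_matI)
    fix i j assume "i < dim_row A3" "j < dim_col A3"
    then have ij: "i < m" "j < m" using A3 by auto
    have "A' $$ (Suc i, Suc j) = mat_adjoint A' $$ (Suc i, Suc j)" using herm' by simp
    also have "\<dots> = cnj (A' $$ (Suc j, Suc i))" using ij A' m by simp
    finally show "mat_adjoint A3 $$ (i, j) = A3 $$ (i, j)"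
      using ij A3 by (simp add: A3_def)
  qed (use A3 in auto)
  let ?E = "mat_diag 1 (\<lambda>_. e)"
  have block: "A' = four_block_mat ?E (0\<^sub>m 1 m) (0\<^sub>m m 1) A3"
  proof (rule eq_matI)
    fix i j assume "i < dim_row (four_block_mat ?E (0\<^sub>m 1 m) (0\<^sub>m m 1) A3)"
      "j < dim_col (four_block_mat ?E (0\<^sub>m 1 m) (0\<^sub>m m 1) A3)"
    then have ij: "i < n" "j < n" using A3 m by (auto simp: mat_diag_def)
    then show "A' $$ (i, j) = four_block_mat ?E (0\<^sub>m 1 m) (0\<^sub>m m 1) A3 $$ (i, j)"
      using col0[of i] row0[of j] m A3 by (cases i; cases j) (auto simp: mat_diag_def A3_def)
  qed (use A' A3 m in \<open>auto simp: mat_diag_def\<close>)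
  have "similar_mat_wit A' A (mat_adjoint W) W"
    by (rule similar_mat_witI[of _ _ n]) (auto simp: A'_def simp del: assoc_mult_mat)
  then have "char_poly A' = [: -e, 1 :] * (\<Prod>e \<leftarrow> es. [:- e, 1:])"
    using char_poly_similar[of A' A] cp by (auto simp: similar_mat_def)
  also have "char_poly A' = char_poly ?E * char_poly A3"
    unfolding block by (rule char_poly_four_block_zeros_col[OF _ _ A3]) (auto simp: mat_diag_def)
  also have "char_poly ?E = [: -e, 1 :]"
    by (subst char_poly_upper_triangular[of _ 1]) (auto simp: mat_diag_def diag_mat_def)
  finally have "char_poly A3 = (\<Prod>e \<leftarrow> es. [:- e, 1:])"
    by (simp only: mult_cancel_left pCons_eq_0_iff) simp
  from Cons.IH[OF A3 A3h this] obtain V where V: "V \<in> carrier_mat m m"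
    and VV: "mat_adjoint V * V = 1\<^sub>m m" "V * mat_adjoint V = 1\<^sub>m m"
    and A3V: "A3 = V * mat_diag m (\<lambda>i. es ! i) * mat_adjoint V" by blast
  define X where "X = four_block_mat (1\<^sub>m 1) (0\<^sub>m 1 m) (0\<^sub>m m 1) V"
  have X: "X \<in> carrier_mat n n" unfolding X_def m using V by auto
  have Xa: "mat_adjoint X = four_block_mat (1\<^sub>m 1) (0\<^sub>m 1 m) (0\<^sub>m m 1) (mat_adjoint V)"
    by (rule eq_matI) (use V in \<open>auto simp: X_def\<close>)
  have X': "mat_adjoint X \<in> carrier_mat n n" using X by simp
  have one: "four_block_mat (1\<^sub>m 1) (0\<^sub>m 1 m) (0\<^sub>m m 1) (1\<^sub>m m) = (1\<^sub>m n :: complex mat)"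
    unfolding m by (rule eq_matI) auto
  have XX: "mat_adjoint X * X = 1\<^sub>m n" "X * mat_adjoint X = 1\<^sub>m n"
    unfolding Xa unfolding X_def
    using V VV one by (simp_all add: block_diag_mult)
  have A'X: "A' = X * mat_diag n (\<lambda>i. (e # es) ! i) * mat_adjoint X"
    unfolding Xa unfolding X_def m mat_diag_Suc block A3V
    using V by (simp add: block_diag_mult square_mat_simps[where n=m] square_mat_simps[where n="Suc 0"] mat_diag_dim[of "Suc 0"])
  define U where "U = W * X"
  note [simp] = X X' XX left_unitary_cancel[OF XX(1)] left_unitary_cancel[OF XX(2)]
  have "A = W * A' * mat_adjoint W" unfolding A'_def by simp
  also have "\<dots> = U * mat_diag n (\<lambda>i. (e # es) ! i) * mat_adjoint U"
    unfolding A'X U_def by simp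
  finally have "A = U * mat_diag n (\<lambda>i. (e # es) ! i) * mat_adjoint U" .
  moreover have "U \<in> carrier_mat n n" "mat_adjoint U * U = 1\<^sub>m n" "U * mat_adjoint U = 1\<^sub>m n"
    unfolding U_def by simp_all
  ultimately show ?case by blast
qed

lemma hermitian_diagonalization:
  fixes A :: "complex mat"
  assumes A: "A \<in> carrier_mat n n" and herm: "mat_adjoint A = A"
  obtains U d where "diagonalizes n U d A" "\<And>i j. i \<le> j \<Longrightarrow> j < n \<Longrightarrow> d j \<le> d i"
proof -
  obtain as where as: "char_poly A = (\<Prod>a\<leftarrow>as. [:- a, 1:])" "length as = n"
    using char_poly_factorized[OF A] by blast
  define es where "es = rev (sort_key Re as)"
  have "mset es = mset as" unfolding es_def by simp
  then have "prod_mset (image_mset (\<lambda>a. [:- a, 1:]) (mset es)) = prod_mset (image_mset (\<lambda>a. [:- a, 1:]) (mset as))"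
    by simp
  then have "char_poly A = (\<Prod>a\<leftarrow>es. [:- a, 1:])"
    unfolding as(1) by (simp add: prod_mset_prod_list flip: mset_map)
  from hermitian_diagonalization_with_spectrum[OF A herm this]
  obtain U where U: "U \<in> carrier_mat n n" "mat_adjoint U * U = 1\<^sub>m n" "U * mat_adjoint U = 1\<^sub>m n"
    and AU: "A = U * mat_diag n (\<lambda>i. es ! i) * mat_adjoint U" by blast
  have U': "mat_adjoint U \<in> carrier_mat n n" using U by simp
  note [simp] = A U U' square_mat_simps[where n=n] left_unitary_cancel[OF U(2)] left_unitary_cancel[OF U(3)]
  have D: "mat_adjoint U * A * U = mat_diag n (\<lambda>i. es ! i)" unfolding AU by simp
  have "mat_adjoint (mat_adjoint U * A * U) = mat_adjoint U * A * U"
    by (simp add: herm)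
  then have Dh: "mat_adjoint (mat_diag n (\<lambda>i. es ! i)) = mat_diag n (\<lambda>i. es ! i)" unfolding D .
  have real: "es ! i = complex_of_real (Re (es ! i))" if "i < n" for i
  proof -
    have "cnj (es ! i) = es ! i"
      using arg_cong[OF Dh, of "\<lambda>M. M $$ (i, i)"] that by (simp add: mat_diag_def)
    then show ?thesis by (simp add: complex_eq_iff)
  qed
  have "mat_diag n (\<lambda>i. es ! i) = rdiag n (\<lambda>i. Re (es ! i))"
    by (rule eq_matI) (auto simp: mat_diag_def real[symmetric])
  with U AU have "diagonalizes n U (\<lambda>i. Re (es ! i)) A" unfolding diagonalizes_def by simp
  moreover have "Re (es ! j) \<le> Re (es ! i)" if "i \<le> j" "j < n" for i j
  proof -
    have "sorted (map Re (sort_key Re as))" by simp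
    then have "Re (sort_key Re as ! (n - Suc j)) \<le> Re (sort_key Re as ! (n - Suc i))"
      using sorted_nth_mono[of "map Re (sort_key Re as)" "n - Suc j" "n - Suc i"] that as(2) by simp
    then show ?thesis using that as(2) by (simp add: es_def rev_nth)
  qed
  ultimately show ?thesis using that by blast
qed

section \<open>Monotonicity of eigenvalues\<close>

text \<open>Fewer equations than unknowns: the unknowns are the entries in \<open>S\<close>, the equations are the
  rows in \<open>T\<close>.\<close>

lemma kernel_vector_with_support:
  fixes R :: "complex mat"
  assumes R: "R \<in> carrier_mat n n" and S: "S \<subseteq> {..<n}" and T: "T \<subseteq> {..<n}" and card: "card T < card S"
  obtains x where "x \<in> carrier_vec n" "x \<noteq> 0\<^sub>v n" "\<And>i. i < n \<Longrightarrow> i \<notin> S \<Longrightarrow> x $ i = 0"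
    "\<And>j. j \<in> T \<Longrightarrow> (R *\<^sub>v x) $ j = 0"
proof -
  have fin: "finite S" "finite T" using S T finite_subset by auto
  obtain g where g: "g ` T \<subseteq> S" "inj_on g T"
    using card_le_inj[OF fin(2,1)] card by auto
  have "card (g ` T) < card S" using card g(2) by (simp add: card_image)
  then have "\<not> S \<subseteq> g ` T" using card_mono[of "g ` T" S] fin by auto
  then obtain k where k: "k \<in> S" "k \<notin> g ` T" by blast
  with S have kn: "k < n" by auto
  \<comment> \<open>Equations \<open>x i = 0\<close> fill the rows outside \<open>S\<close>, the rows of \<open>R\<close> with index in \<open>T\<close> are moved
    injectively into rows of \<open>S\<close>, and row \<open>k\<close> remains zero, which makes \<open>G\<close> singular.\<close>
  define G where "G = Matrix.mat n n (\<lambda>(i, j).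
    if i \<notin> S then (if i = j then 1 else 0)
    else if i \<in> g ` T then R $$ (inv_into T g i, j) else 0)"
  have G: "G \<in> carrier_mat n n" unfolding G_def by simp
  have Gk: "G $$ (k, j) = 0" if "j < n" for j using k kn that by (simp add: G_def)
  have "transpose_mat G *\<^sub>v unit_vec n k = 0\<^sub>v n"
  proof (rule eq_vecI)
    fix j assume "j < dim_vec (0\<^sub>v n :: complex vec)"
    then have j: "j < n" by simp
    have "(transpose_mat G *\<^sub>v unit_vec n k) $ j = col G j \<bullet> unit_vec n k" using G j by simp
    also have "\<dots> = col G j $ k" by (rule scalar_prod_right_unit[OF kn]) 
    also have "\<dots> = 0" using Gk[OF j] G j kn by simp
    finally show "(transpose_mat G *\<^sub>v unit_vec n k) $ j = (0\<^sub>v n :: complex vec) $ j" using j by simp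
  qed (use G in auto)
  moreover have "unit_vec n k \<noteq> (0\<^sub>v n :: complex vec)"
    using arg_cong[of "unit_vec n k" "0\<^sub>v n :: complex vec" "\<lambda>v. v $ k"] kn by auto
  moreover have "transpose_mat G \<in> carrier_mat n n" using G by simp
  ultimately have "det (transpose_mat G) = 0"
    using det_0_iff_vec_prod_zero[of "transpose_mat G" n] unit_vec_carrier by blast
  then have "det G = 0" using det_transpose[OF G] by simp
  then obtain x where x: "x \<in> carrier_vec n" "x \<noteq> 0\<^sub>v n" "G *\<^sub>v x = 0\<^sub>v n"
    using det_0_iff_vec_prod_zero[OF G] by auto
  have Gx: "(\<Sum>j<n. G $$ (i, j) * x $ j) = 0" if "i < n" for i
    using arg_cong[OF x(3), of "\<lambda>v. v $ i"] that G x(1) by (simp add: scalar_prod_def atLeast0LessThan)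
  have "x $ i = 0" if i: "i < n" "i \<notin> S" for i
  proof -
    have "(\<Sum>j<n. G $$ (i, j) * x $ j) = (\<Sum>j<n. if i = j then x $ j else 0)"
      using i by (intro sum.cong) (auto simp: G_def)
    then show ?thesis using Gx[OF i(1)] i by simp
  qed
  moreover have "(R *\<^sub>v x) $ j = 0" if j: "j \<in> T" for j
  proof -
    have gj: "g j \<in> S" "g j < n" "j < n" using g(1) S T j by auto
    have "(R *\<^sub>v x) $ j = (\<Sum>l<n. G $$ (g j, l) * x $ l)"
      using gj R x(1) j g(2) by (auto simp: scalar_prod_def atLeast0LessThan G_def intro!: sum.cong)
    then show ?thesis using Gx[OF gj(2)] by simp
  qed
  ultimately show ?thesis using that x by blast
qed

text \<open>Monotonicity of eigenvalues (Courant--Fischer, Weyl) in a form that does not presuppose an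
  order of the eigenvalues.  The span of the eigenvectors of \<open>A\<close> with index in \<open>S\<close> has larger
  dimension than the span of those of \<open>N\<close> with index in \<open>T\<close>; hence it contains a nonzero \<open>x\<close>
  orthogonal to the latter, and the form of \<open>A\<close> at \<open>x\<close> is at least \<open>\<alpha>\<close> times, the form of \<open>N\<close> at
  most \<open>\<beta>\<close> times the squared norm.\<close>

lemma eigenvalue_comparison:
  assumes U: "diagonalizes n U a A" and V: "diagonalizes n V e N"
    and le: "\<And>x. x \<in> carrier_vec n \<Longrightarrow> qform A x \<le> qform N x"
    and S: "S \<subseteq> {..<n}" and T: "T \<subseteq> {..<n}" and card: "card T < card S"
    and alpha: "\<And>i. i \<in> S \<Longrightarrow> \<alpha> \<le> a i" and beta: "\<And>i. i < n \<Longrightarrow> i \<notin> T \<Longrightarrow> e i \<le> \<beta>"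
  shows "\<alpha> \<le> \<beta>"
proof -
  note u = diagonalizesD[OF U] and v = diagonalizesD[OF V]
  obtain y where y: "y \<in> carrier_vec n" "y \<noteq> 0\<^sub>v n" "\<And>i. i < n \<Longrightarrow> i \<notin> S \<Longrightarrow> y $ i = 0"
    and yT: "\<And>j. j \<in> T \<Longrightarrow> (mat_adjoint V * U *\<^sub>v y) $ j = 0"
    using kernel_vector_with_support[OF mult_carrier_mat[OF v(6) u(1)] S T card] by blast
  define x where "x = U *\<^sub>v y"
  have x: "x \<in> carrier_vec n" unfolding x_def using u(1) y(1) by (rule mult_mat_vec_carrier)
  have Ux: "mat_adjoint U *\<^sub>v x = y"
    unfolding x_def using u(1,2,6) y(1) by (simp flip: assoc_mult_mat_vec[of _ n n _ n])
  have Vx: "(mat_adjoint V *\<^sub>v x) $ j = 0" if "j \<in> T" for j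
    using yT[OF that] unfolding x_def assoc_mult_mat_vec[OF v(6) u(1) y(1)] .
  have "\<alpha> * (cmod (y $ i))\<^sup>2 \<le> a i * (cmod (y $ i))\<^sup>2" if "i < n" for i
    using y(3)[OF that] alpha[of i] by (cases "i \<in> S") (auto intro: mult_right_mono)
  then have "\<alpha> * sqnorm y \<le> qform A x"
    unfolding qform_diagonalizes[OF U x] Ux sqnorm_def sum_distrib_left
    using y(1) by (auto intro!: sum_mono)
  also have "\<dots> \<le> qform N x" by (rule le[OF x])
  also have "\<dots> \<le> \<beta> * sqnorm (mat_adjoint V *\<^sub>v x)"
  proof -
    have "e i * (cmod ((mat_adjoint V *\<^sub>v x) $ i))\<^sup>2 \<le> \<beta> * (cmod ((mat_adjoint V *\<^sub>v x) $ i))\<^sup>2"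
      if "i < n" for i
      using Vx[of i] beta[OF that] by (cases "i \<in> T") (auto intro: mult_right_mono)
    then show ?thesis
      unfolding qform_diagonalizes[OF V x] sqnorm_def sum_distrib_left
      using v(1) by (auto intro!: sum_mono)
  qed
  also have "sqnorm (mat_adjoint V *\<^sub>v x) = sqnorm x" by (rule sqnorm_unitary[OF v(1,3) x])
  also have "sqnorm x = sqnorm (mat_adjoint U *\<^sub>v x)" by (rule sqnorm_unitary[OF u(1,3) x, symmetric])
  finally have le: "\<alpha> * sqnorm y \<le> \<beta> * sqnorm y" unfolding Ux .
  have "\<exists>i<n. y $ i \<noteq> 0"
  proof (rule ccontr)
    assume "\<not> (\<exists>i<n. y $ i \<noteq> 0)"
    then have "y = 0\<^sub>v n" using y(1) by (intro eq_vecI) auto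
    with y(2) show False ..
  qed
  then obtain i where "i < n" "y $ i \<noteq> 0" by blast
  then have "0 < sqnorm y" unfolding sqnorm_def using y(1) by (intro sum_pos2[where i = i]) auto
  with le show ?thesis by simp
qed

section \<open>Eigenvalues of a congruence by a diagonal matrix\<close>

lemma qform_add_smult:
  assumes A: "A \<in> carrier_mat n n" and u: "u \<in> carrier_vec n" and w: "w \<in> carrier_vec n"
  shows "qform A (u + complex_of_real c \<cdot>\<^sub>v w) =
    qform A u + c * (Re ((A *\<^sub>v u) \<bullet>c w) + Re ((A *\<^sub>v w) \<bullet>c u)) + c\<^sup>2 * qform A w"
proof -
  define x y where "x = A *\<^sub>v u" and "y = A *\<^sub>v w"
  have xy: "x \<in> carrier_vec n" "y \<in> carrier_vec n"
    unfolding x_def y_def using A u w by (auto intro: mult_mat_vec_carrier)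
  have "A *\<^sub>v (u + complex_of_real c \<cdot>\<^sub>v w) = x + complex_of_real c \<cdot>\<^sub>v y"
    unfolding x_def y_def using A u w
    by (simp add: mult_add_distrib_mat_vec[of _ n n] mult_mat_vec[of _ n n])
  then show ?thesis
    unfolding qform_def x_def[symmetric] y_def[symmetric] using xy u w
    by (simp add: scalar_prod_def sum.distrib sum_subtractf algebra_simps sum_distrib_left power2_eq_square)
qed

text \<open>The difference of the two sides is \<open>\<delta>\<close> times the form of \<open>A\<close> at \<open>u - w\<close>.\<close>

lemma qform_perturbation_le:
  assumes A: "A \<in> carrier_mat n n" and psd: "\<And>x. x \<in> carrier_vec n \<Longrightarrow> 0 \<le> qform A x"
    and u: "u \<in> carrier_vec n" and w: "w \<in> carrier_vec n" and \<delta>: "\<delta> \<ge> 0"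
  shows "qform A (u + complex_of_real \<delta> \<cdot>\<^sub>v w) \<le> (1 + \<delta>) * qform A u + (\<delta> + \<delta>\<^sup>2) * qform A w"
proof -
  have "0 \<le> \<delta> * qform A (u + complex_of_real (- 1) \<cdot>\<^sub>v w)"
    using psd u w \<delta> by (intro mult_nonneg_nonneg) auto
  then show ?thesis
    unfolding qform_add_smult[OF A u w] by (simp add: algebra_simps)
qed

lemma positive_semidefinite_qform:
  assumes "positive_semidefinite A" "A \<in> carrier_mat n n" "x \<in> carrier_vec n"
  shows "0 \<le> qform A x"
  using assms unfolding positive_semidefinite_def qform_def by (auto simp: less_eq_complex_def)

lemma eigenvalue_nonneg:
  assumes U: "diagonalizes n U a A" and psd: "\<And>x. x \<in> carrier_vec n \<Longrightarrow> 0 \<le> qform A x"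
    and i: "i < n"
  shows "0 \<le> a i"
proof -
  note u = diagonalizesD[OF U]
  define x where "x = U *\<^sub>v unit_vec n i"
  have x: "x \<in> carrier_vec n" unfolding x_def using u(1) by (auto intro: mult_mat_vec_carrier)
  have Ux: "mat_adjoint U *\<^sub>v x = unit_vec n i"
    unfolding x_def using u(1,2,6) by (simp flip: assoc_mult_mat_vec[of _ n n _ n])
  have "qform A x = (\<Sum>j<n. if j = i then a j else 0)"
    unfolding qform_diagonalizes[OF U x] Ux using i by (intro sum.cong) auto
  with psd[OF x] i show ?thesis by simp
qed

lemma rdiag_mult_vec:
  assumes "x \<in> carrier_vec n"
  shows "rdiag n d *\<^sub>v x = Matrix.vec n (\<lambda>i. complex_of_real (d i) * x $ i)"
proof (rule eq_vecI)
  fix i assume "i < dim_vec (Matrix.vec n (\<lambda>i. complex_of_real (d i) * x $ i))"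
  then have i: "i < n" by simp
  have "(rdiag n d *\<^sub>v x) $ i = (\<Sum>j<n. (if i = j then complex_of_real (d j) else 0) * x $ j)"
    using i assms by (simp add: mat_diag_def scalar_prod_def atLeast0LessThan)
  also have "\<dots> = (\<Sum>j<n. if i = j then complex_of_real (d j) * x $ j else 0)"
    by (intro sum.cong) auto
  finally show "(rdiag n d *\<^sub>v x) $ i = Matrix.vec n (\<lambda>i. complex_of_real (d i) * x $ i) $ i"
    using i by simp
qed (auto simp: mat_diag_def)

lemma det_rdiag: "det (rdiag n d) = complex_of_real (\<Prod>i<n. d i)"
  by (rule det_diagonalizes[OF diagonalizes_rdiag])

text \<open>The square root \<open>sqrt (b i)\<close> is replaced by the invertible \<open>\<beta> i = sqrt (b i) + \<delta>\<close>.  With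
  \<open>D = diag (sqrt b)\<close>, the matrix \<open>(D + \<delta>) A (D + \<delta>)\<close> differs from \<open>(1 + \<delta>) D A D + (\<delta> + \<delta>^2) A\<close>
  by \<open>\<delta> (D - 1) A (D - 1)\<close>.  As \<open>A \<le> K\<close>, it is therefore dominated by the matrix \<open>M\<close> with the
  eigenvectors of \<open>D A D\<close> and the eigenvalues \<open>m i\<close>, the factors on the right-hand side.  Consequently
  \<open>N = (D + \<delta>)^(-1) M (D + \<delta>)^(-1)\<close> dominates \<open>A\<close>.  It also dominates \<open>t (D + \<delta>)^(-2)\<close>, since all
  \<open>m i\<close> are at least \<open>t\<close>.  The determinant of \<open>N\<close> combines the two resulting bounds on its
  eigenvalues.\<close>

lemma perturbed_prod_max_bound:
  assumes U: "diagonalizes n U a A" and a_dec: "\<And>i j. i \<le> j \<Longrightarrow> j < n \<Longrightarrow> a j \<le> a i"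
    and psd: "\<And>x. x \<in> carrier_vec n \<Longrightarrow> 0 \<le> qform A x"
    and b0: "\<And>i. i < n \<Longrightarrow> 0 \<le> b i" and b_dec: "\<And>i j. i \<le> j \<Longrightarrow> j < n \<Longrightarrow> b j \<le> b i"
    and Z: "diagonalizes n Z z (rdiag n (\<lambda>i. sqrt (b i)) * A * rdiag n (\<lambda>i. sqrt (b i)))"
    and K: "0 \<le> K" "\<And>i. i < n \<Longrightarrow> a i \<le> K" and t: "t > 0" and \<delta>: "\<delta> > 0"
  shows "(\<Prod>i<n. max (a i * b (n - Suc i)) t) \<le> (\<Prod>i<n. (1 + \<delta>) * max (z i) t + (\<delta> + \<delta>\<^sup>2) * K)"
proof -
  define \<beta> where "\<beta> i = sqrt (b i) + \<delta>" for i
  define m where "m i = (1 + \<delta>) * max (z i) t + (\<delta> + \<delta>\<^sup>2) * K" for i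
  define M where "M = Z * rdiag n m * mat_adjoint Z"
  define E where "E = rdiag n (\<lambda>i. 1 / \<beta> i)"
  define N where "N = E * M * E"
  note u = diagonalizesD[OF U] and zz = diagonalizesD[OF Z]
  have \<beta>_pos: "0 < \<beta> i" if "i < n" for i
    unfolding \<beta>_def using b0[OF that] \<delta> by (intro add_nonneg_pos) auto
  have M: "diagonalizes n Z m M" unfolding diagonalizes_def M_def using zz(1-3) by simp
  note mm = diagonalizesD[OF M]
  have E: "E \<in> carrier_mat n n" "mat_adjoint E = E" unfolding E_def by (rule mat_diag_dim adjoint_rdiag)+
  have N: "N \<in> carrier_mat n n" unfolding N_def using E mm(5) by (intro mult_carrier_mat[of _ n n])
  have "mat_adjoint N = N"
    unfolding N_def using E mm(5,7) by (simp add: square_mat_simps[where n = n])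
  then obtain V \<nu> where V: "diagonalizes n V \<nu> N" and \<nu>_dec: "\<And>i j. i \<le> j \<Longrightarrow> j < n \<Longrightarrow> \<nu> j \<le> \<nu> i"
    using hermitian_diagonalization[OF N] by blast
  have qN: "qform N x = qform M (E *\<^sub>v x)" if "x \<in> carrier_vec n" for x
    unfolding N_def using qform_conj[OF E(1) mm(5) that] E(2) by simp
  have qM: "qform M y = (\<Sum>i<n. m i * (cmod ((mat_adjoint Z *\<^sub>v y) $ i))\<^sup>2)"
    if "y \<in> carrier_vec n" for y by (rule qform_diagonalizes[OF M that])
  have norm_y: "sqnorm y = (\<Sum>i<n. (cmod ((mat_adjoint Z *\<^sub>v y) $ i))\<^sup>2)"
    if "y \<in> carrier_vec n" for y
    using sqnorm_unitary[OF zz(1,3) that] zz(1) unfolding sqnorm_def by simp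
  have Ex: "E *\<^sub>v x \<in> carrier_vec n" if "x \<in> carrier_vec n" for x
    using E(1) that by (rule mult_mat_vec_carrier)
  have AN: "qform A x \<le> qform N x" if x: "x \<in> carrier_vec n" for x
  proof -
    define y where "y = E *\<^sub>v x"
    have y: "y \<in> carrier_vec n" unfolding y_def by (rule Ex[OF x])
    define u where "u = rdiag n (\<lambda>i. sqrt (b i)) *\<^sub>v y"
    have u: "u \<in> carrier_vec n" unfolding u_def using y by (simp add: rdiag_mult_vec)
    have "x = u + complex_of_real \<delta> \<cdot>\<^sub>v y"
    proof (rule eq_vecI)
      fix i assume "i < dim_vec (u + complex_of_real \<delta> \<cdot>\<^sub>v y)"
      then have i: "i < n" using y by simp
      have "(u + complex_of_real \<delta> \<cdot>\<^sub>v y) $ i = complex_of_real (\<beta> i) * y $ i"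
        using i y unfolding u_def \<beta>_def by (simp add: rdiag_mult_vec algebra_simps)
      also have "\<dots> = complex_of_real (\<beta> i) * (complex_of_real (1 / \<beta> i) * x $ i)"
        using i x unfolding y_def E_def by (simp only: rdiag_mult_vec index_vec)
      also have "\<dots> = x $ i" using \<beta>_pos[OF i] by simp
      finally show "x $ i = (u + complex_of_real \<delta> \<cdot>\<^sub>v y) $ i" by simp
    qed (use x y in auto)
    then have "qform A x \<le> (1 + \<delta>) * qform A u + (\<delta> + \<delta>\<^sup>2) * qform A y"
      using qform_perturbation_le[OF diagonalizesD(5)[OF U] psd u y, of \<delta>] \<delta> by simp
    also have "qform A u = (\<Sum>i<n. z i * (cmod ((mat_adjoint Z *\<^sub>v y) $ i))\<^sup>2)"
      using qform_conj[of "rdiag n (\<lambda>i. sqrt (b i))" n n A y] y diagonalizesD(5)[OF U]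
        qform_diagonalizes[OF Z y] unfolding u_def by simp
    also have "(1 + \<delta>) * (\<Sum>i<n. z i * (cmod ((mat_adjoint Z *\<^sub>v y) $ i))\<^sup>2) + (\<delta> + \<delta>\<^sup>2) * qform A y
        \<le> (1 + \<delta>) * (\<Sum>i<n. z i * (cmod ((mat_adjoint Z *\<^sub>v y) $ i))\<^sup>2) + (\<delta> + \<delta>\<^sup>2) * (K * sqnorm y)"
    proof (intro add_left_mono mult_left_mono)
      have "qform A y = (\<Sum>i<n. a i * (cmod ((mat_adjoint U *\<^sub>v y) $ i))\<^sup>2)"
        by (rule qform_diagonalizes[OF U y])
      also have "\<dots> \<le> (\<Sum>i<n. K * (cmod ((mat_adjoint U *\<^sub>v y) $ i))\<^sup>2)"
        by (intro sum_mono mult_right_mono K) auto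
      also have "\<dots> = K * sqnorm (mat_adjoint U *\<^sub>v y)"
        unfolding sqnorm_def sum_distrib_left using diagonalizesD(1)[OF U] by simp
      also have "sqnorm (mat_adjoint U *\<^sub>v y) = sqnorm y"
        by (rule sqnorm_unitary[OF diagonalizesD(1,3)[OF U] y])
      finally show "qform A y \<le> K * sqnorm y" .
    qed (use \<delta> in auto)
    also have "(1 + \<delta>) * (\<Sum>i<n. z i * (cmod ((mat_adjoint Z *\<^sub>v y) $ i))\<^sup>2) + (\<delta> + \<delta>\<^sup>2) * (K * sqnorm y)
        = (\<Sum>i<n. ((1 + \<delta>) * z i + (\<delta> + \<delta>\<^sup>2) * K) * (cmod ((mat_adjoint Z *\<^sub>v y) $ i))\<^sup>2)"
      unfolding norm_y[OF y] by (simp add: sum_distrib_left sum.distrib algebra_simps)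
    also have "\<dots> \<le> qform M y"
      unfolding qM[OF y] m_def using \<delta> by (intro sum_mono mult_right_mono add_right_mono mult_left_mono) auto
    finally show ?thesis unfolding qN[OF x] y_def .
  qed
  have tN: "qform (rdiag n (\<lambda>i. t / (\<beta> i)\<^sup>2)) x \<le> qform N x" if x: "x \<in> carrier_vec n" for x
  proof -
    define y where "y = E *\<^sub>v x"
    have y: "y \<in> carrier_vec n" unfolding y_def by (rule Ex[OF x])
    have y_eq: "y = Matrix.vec n (\<lambda>i. complex_of_real (1 / \<beta> i) * x $ i)"
      unfolding y_def E_def by (rule rdiag_mult_vec[OF x])
    have "qform (rdiag n (\<lambda>i. t / (\<beta> i)\<^sup>2)) x = (\<Sum>i<n. t / (\<beta> i)\<^sup>2 * (cmod (x $ i))\<^sup>2)"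
      by (rule qform_rdiag[OF x])
    also have "\<dots> = t * sqnorm y"
      unfolding sqnorm_def sum_distrib_left
      by (intro sum.cong) (auto simp: y_eq norm_divide power_divide norm_mult power_mult_distrib)
    also have "\<dots> \<le> qform M y"
      unfolding norm_y[OF y] qM[OF y] sum_distrib_left
    proof (intro sum_mono mult_right_mono)
      fix i
      have "1 * t \<le> (1 + \<delta>) * max (z i) t" using \<delta> t by (intro mult_mono) auto
      moreover have "0 \<le> (\<delta> + \<delta>\<^sup>2) * K" using \<delta> K by (intro mult_nonneg_nonneg) auto
      ultimately show "t \<le> m i" unfolding m_def by simp
    qed auto
    finally show ?thesis unfolding qN[OF x] y_def .
  qed
  have \<nu>_a: "a i \<le> \<nu> i" if i: "i < n" for i
    by (rule eigenvalue_comparison[OF U V AN, of "{..i}" "{..<i}"])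
      (use i a_dec \<nu>_dec in auto)
  \<comment> \<open>The diagonal entries \<open>t / (\<beta> j)^2\<close> are nondecreasing in \<open>j\<close>, so the largest \<open>Suc i\<close> of them are the
    last ones.\<close>
  have \<nu>_t: "t / (\<beta> (n - Suc i))\<^sup>2 \<le> \<nu> i" if i: "i < n" for i
  proof (rule eigenvalue_comparison[OF diagonalizes_rdiag V tN, of "{n - Suc i..<n}" "{..<i}"])
    fix j assume j: "j \<in> {n - Suc i..<n}"
    then have "\<beta> j \<le> \<beta> (n - Suc i)" unfolding \<beta>_def using b_dec by simp
    then have "(\<beta> j)\<^sup>2 \<le> (\<beta> (n - Suc i))\<^sup>2" using \<beta>_pos[of j] j by (intro power_mono) auto
    then show "t / (\<beta> (n - Suc i))\<^sup>2 \<le> t / (\<beta> j)\<^sup>2"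
      using t \<beta>_pos[of j] j by (intro divide_left_mono) (auto intro!: mult_pos_pos)
  qed (use i \<nu>_dec in auto)
  have "complex_of_real (\<Prod>i<n. \<nu> i) = det N" using det_diagonalizes[OF V] by simp
  also have "\<dots> = det E * det M * det E"
    unfolding N_def using E mm(5) by (simp add: det_mult[of _ n] mult_carrier_mat[of _ n n])
  also have "\<dots> = complex_of_real (\<Prod>i<n. 1 / \<beta> i * m i * (1 / \<beta> i))"
    unfolding E_def det_rdiag det_diagonalizes[OF M] by (simp only: prod.distrib of_real_mult)
  finally have "(\<Prod>i<n. \<nu> i) = (\<Prod>i<n. 1 / \<beta> i * m i * (1 / \<beta> i))"
    by (simp only: of_real_eq_iff)
  then have "(\<Prod>i<n. \<nu> i) * (\<Prod>i<n. (\<beta> i)\<^sup>2) = (\<Prod>i<n. 1 / \<beta> i * m i * (1 / \<beta> i) * (\<beta> i)\<^sup>2)"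
    by (simp only: prod.distrib)
  also have "\<dots> = (\<Prod>i<n. m i)"
  proof (intro prod.cong refl)
    fix i assume "i \<in> {..<n}"
    then have "\<beta> i \<noteq> 0" using \<beta>_pos[of i] by simp
    then show "1 / \<beta> i * m i * (1 / \<beta> i) * (\<beta> i)\<^sup>2 = m i" by (simp add: power2_eq_square)
  qed
  also have "(\<Prod>i<n. (\<beta> i)\<^sup>2) = (\<Prod>i<n. (\<beta> (n - Suc i))\<^sup>2)"
    by (rule prod.nat_diff_reindex[symmetric])
  finally have m_eq: "(\<Prod>i<n. \<nu> i * (\<beta> (n - Suc i))\<^sup>2) = (\<Prod>i<n. m i)"
    by (simp only: prod.distrib)
  have "(\<Prod>i<n. max (a i * b (n - Suc i)) t) \<le> (\<Prod>i<n. \<nu> i * (\<beta> (n - Suc i))\<^sup>2)"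
  proof (rule prod_mono, rule conjI)
    fix i assume "i \<in> {..<n}"
    then have i: "i < n" "n - Suc i < n" by auto
    have a0: "0 \<le> a i" by (rule eigenvalue_nonneg[OF U psd i(1)])
    have "b (n - Suc i) = (sqrt (b (n - Suc i)))\<^sup>2" using b0[OF i(2)] by simp
    also have "\<dots> \<le> (\<beta> (n - Suc i))\<^sup>2" unfolding \<beta>_def using \<delta> b0[OF i(2)] by (intro power_mono) auto
    finally have "a i * b (n - Suc i) \<le> \<nu> i * (\<beta> (n - Suc i))\<^sup>2"
      using \<nu>_a[OF i(1)] a0 b0[OF i(2)] by (intro mult_mono) auto
    moreover have "t \<le> \<nu> i * (\<beta> (n - Suc i))\<^sup>2"
      using \<nu>_t[OF i(1)] \<beta>_pos[OF i(2)] by (simp add: divide_simps)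
    ultimately show "max (a i * b (n - Suc i)) t \<le> \<nu> i * (\<beta> (n - Suc i))\<^sup>2" by simp
    show "0 \<le> max (a i * b (n - Suc i)) t" using t by simp
  qed
  then show ?thesis unfolding m_eq m_def .
qed

text \<open>The case \<open>r = 0\<close> of the trace inequality.  The products over the truncated eigenvalues are
  compared by letting \<open>\<delta>\<close> tend to \<open>0\<close> in the perturbed bound.\<close>

lemma sum_powr_eigenvalues_product_ge:
  assumes U: "diagonalizes n U a A" and a_dec: "\<And>i j. i \<le> j \<Longrightarrow> j < n \<Longrightarrow> a j \<le> a i"
    and psd: "\<And>x. x \<in> carrier_vec n \<Longrightarrow> 0 \<le> qform A x"
    and b0: "\<And>i. i < n \<Longrightarrow> 0 \<le> b i" and b_dec: "\<And>i j. i \<le> j \<Longrightarrow> j < n \<Longrightarrow> b j \<le> b i"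
    and Z: "diagonalizes n Z z (rdiag n (\<lambda>i. sqrt (b i)) * A * rdiag n (\<lambda>i. sqrt (b i)))"
    and z0: "\<And>i. i < n \<Longrightarrow> 0 \<le> z i" and s: "s > 0"
  shows "(\<Sum>i<n. (a i * b (n - Suc i)) powr s) \<le> (\<Sum>i<n. z i powr s)"
proof (rule sum_powr_le_of_prod_max_le[OF s])
  have a0: "0 \<le> a i" if "i < n" for i by (rule eigenvalue_nonneg[OF U psd that])
  show "0 \<le> a i * b (n - Suc i)" if "i < n" for i using a0 b0 that by simp
  fix t :: real assume t: "t > 0"
  define K where "K = (\<Sum>i<n. a i)"
  have K: "0 \<le> K" unfolding K_def by (intro sum_nonneg a0) auto
  have aK: "a i \<le> K" if "i < n" for i
    unfolding K_def using that a0 by (intro member_le_sum) auto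
  let ?f = "\<lambda>\<delta>. \<Prod>i<n. (1 + \<delta>) * max (z i) t + (\<delta> + \<delta>\<^sup>2) * K"
  have "(?f \<longlongrightarrow> (\<Prod>i<n. (1 + 0) * max (z i) t + (0 + 0\<^sup>2) * K)) (at_right 0)"
    by (intro tendsto_prod tendsto_add tendsto_mult tendsto_const tendsto_power tendsto_ident_at)
  then have lim: "(?f \<longlongrightarrow> (\<Prod>i<n. max (z i) t)) (at_right 0)" by simp
  have "(\<Prod>i<n. max (a i * b (n - Suc i)) t) \<le> ?f \<delta>" if "\<delta> > 0" for \<delta>
    by (rule perturbed_prod_max_bound[OF U a_dec psd b0 b_dec Z K aK t that])
  then have "eventually (\<lambda>\<delta>. (\<Prod>i<n. max (a i * b (n - Suc i)) t) \<le> ?f \<delta>) (at_right 0)"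
    by (intro eventually_at_rightI[of 0 1]) simp_all
  then show "(\<Prod>i<n. max (a i * b (n - Suc i)) t) \<le> (\<Prod>i<n. max (z i) t)"
    by (intro tendsto_lowerbound[OF lim]) simp_all
qed (use z0 in auto)

section \<open>Compression and weighted traces\<close>

lemma diag_entry_adjoint_conj:
  assumes X: "X \<in> carrier_mat n n" and j: "j < n"
  shows "(mat_adjoint X * (rdiag n d * X)) $$ (j, j) = complex_of_real (\<Sum>l<n. d l * (cmod (X $$ (l, j)))\<^sup>2)"
proof -
  have "(mat_adjoint X * (rdiag n d * X)) $$ (j, j) = (\<Sum>l<n. mat_adjoint X $$ (j, l) * (rdiag n d * X) $$ (l, j))"
    using X j by (intro mult_mat_index_sum[of _ n n _ n] mult_carrier_mat[of _ n n]) auto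
  also have "\<dots> = (\<Sum>l<n. complex_of_real (d l) * (X $$ (l, j) * cnj (X $$ (l, j))))"
    using X j by (intro sum.cong) (auto simp: mat_diag_mult_left[OF X] ac_simps)
  also have "\<dots> = complex_of_real (\<Sum>l<n. d l * (cmod (X $$ (l, j)))\<^sup>2)"
    by (simp add: complex_norm_square[symmetric])
  finally show ?thesis .
qed

text \<open>Jensen's trace inequality for the compression of \<open>C\<close> to the first \<open>k\<close> coordinates, on which
  \<open>P\<close> projects.  With \<open>T = W^* P Z\<close> each eigenvalue \<open>z j\<close> of \<open>P C P\<close> is the combination of the \<open>c l\<close>
  with the weights \<open>|T (l, j)|^2\<close>.  For fixed \<open>j\<close> they add up to \<open>|P Z e_j|^2 \<le> 1\<close>, and for fixed \<open>l\<close>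
  to \<open>|P W e_l|^2\<close>, whence the weights on the right-hand side.\<close>

lemma sum_powr_compression_le:
  assumes W: "diagonalizes n W c C" and c0: "\<And>i. i < n \<Longrightarrow> 0 \<le> c i" and k: "k \<le> n" and s: "s \<ge> 1"
    and Z: "diagonalizes n Z z (rdiag n (\<lambda>i. if i < k then 1 else 0) * C * rdiag n (\<lambda>i. if i < k then 1 else 0))"
  shows "(\<Sum>j<n. z j powr s) \<le> (\<Sum>i<k. \<Sum>l<n. (cmod (W $$ (i, l)))\<^sup>2 * c l powr s)"
proof -
  note w = diagonalizesD[OF W] and zz = diagonalizesD[OF Z]
  define e :: "nat \<Rightarrow> real" where "e i = (if i < k then 1 else 0)" for i
  define P where "P = rdiag n e"
  define T where "T = mat_adjoint W * (P * Z)"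
  have P: "P \<in> carrier_mat n n" "mat_adjoint P = P" unfolding P_def by simp_all
  have PP: "P * P = P" unfolding P_def by (simp add: e_def if_distrib cong: if_cong)
  have PPX: "P * (P * X) = P * X" if "X \<in> carrier_mat n n" for X
    using PP P(1) that by (simp flip: assoc_mult_mat[of P n n P n X n])
  have I: "rdiag n (\<lambda>_. 1) = 1\<^sub>m n" by simp
  have Zeq: "P * C * P = Z * rdiag n z * mat_adjoint Z"
    using zz(4) unfolding P_def e_def .
  note [simp] = square_mat_simps[where n = n] P PP PPX w(1,2,3,6) zz(1,2,3,6)
    left_unitary_cancel[OF w(2)] left_unitary_cancel[OF w(3)]
    left_unitary_cancel[OF zz(2)] left_unitary_cancel[OF zz(3)]
  have T: "T \<in> carrier_mat n n" and T': "mat_adjoint T \<in> carrier_mat n n" unfolding T_def by simp_all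
  have "mat_adjoint T * (rdiag n c * T) = mat_adjoint Z * (P * (W * rdiag n c * mat_adjoint W) * P) * Z"
    unfolding T_def by simp
  also have "\<dots> = rdiag n z" unfolding w(4)[symmetric] Zeq by simp
  finally have TcT: "mat_adjoint T * (rdiag n c * T) = rdiag n z" .
  have TT: "mat_adjoint T * (rdiag n (\<lambda>_. 1) * T) = mat_adjoint Z * (rdiag n e * Z)"
    unfolding I using T unfolding T_def by (simp flip: P_def)
  have ZZ: "mat_adjoint Z * (rdiag n (\<lambda>_. 1) * Z) = 1\<^sub>m n" unfolding I by simp
  have TTa: "mat_adjoint (mat_adjoint T) * (rdiag n (\<lambda>_. 1) * mat_adjoint T) = mat_adjoint W * (rdiag n e * W)"
    unfolding I using T unfolding T_def by (simp flip: P_def)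
  have z_eq: "z j = (\<Sum>l<n. (cmod (T $$ (l, j)))\<^sup>2 * c l)" if j: "j < n" for j
  proof -
    have "complex_of_real (z j) = rdiag n z $$ (j, j)" using j by (simp add: mat_diag_def)
    also have "\<dots> = complex_of_real (\<Sum>l<n. c l * (cmod (T $$ (l, j)))\<^sup>2)"
      unfolding TcT[symmetric] by (rule diag_entry_adjoint_conj[OF T j])
    finally show ?thesis by (simp only: of_real_eq_iff mult.commute)
  qed
  have col: "(\<Sum>l<n. (cmod (T $$ (l, j)))\<^sup>2) \<le> 1" if j: "j < n" for j
  proof -
    have "complex_of_real (\<Sum>l<n. 1 * (cmod (T $$ (l, j)))\<^sup>2) = complex_of_real (\<Sum>l<n. e l * (cmod (Z $$ (l, j)))\<^sup>2)"
      unfolding diag_entry_adjoint_conj[OF T j, symmetric] diag_entry_adjoint_conj[OF zz(1) j, symmetric] TT ..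
    then have "(\<Sum>l<n. (cmod (T $$ (l, j)))\<^sup>2) = (\<Sum>l<n. e l * (cmod (Z $$ (l, j)))\<^sup>2)"
      by (simp only: of_real_eq_iff mult_1)
    also have "\<dots> \<le> (\<Sum>l<n. 1 * (cmod (Z $$ (l, j)))\<^sup>2)"
      by (intro sum_mono mult_right_mono) (auto simp: e_def)
    also have "complex_of_real (\<Sum>l<n. 1 * (cmod (Z $$ (l, j)))\<^sup>2) = complex_of_real 1"
      unfolding diag_entry_adjoint_conj[OF zz(1) j, symmetric] ZZ using j by simp
    then have "(\<Sum>l<n. 1 * (cmod (Z $$ (l, j)))\<^sup>2) = 1" by (simp only: of_real_eq_iff)
    finally show ?thesis .
  qed
  have row: "(\<Sum>j<n. (cmod (T $$ (l, j)))\<^sup>2) = (\<Sum>i<k. (cmod (W $$ (i, l)))\<^sup>2)" if l: "l < n" for l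
  proof -
    have "complex_of_real (\<Sum>j<n. 1 * (cmod (mat_adjoint T $$ (j, l)))\<^sup>2) = complex_of_real (\<Sum>i<n. e i * (cmod (W $$ (i, l)))\<^sup>2)"
      unfolding diag_entry_adjoint_conj[OF T' l, symmetric] diag_entry_adjoint_conj[OF w(1) l, symmetric] TTa ..
    then have "(\<Sum>j<n. (cmod (mat_adjoint T $$ (j, l)))\<^sup>2) = (\<Sum>i<n. e i * (cmod (W $$ (i, l)))\<^sup>2)"
      by (simp only: of_real_eq_iff mult_1)
    also have "(\<Sum>j<n. (cmod (mat_adjoint T $$ (j, l)))\<^sup>2) = (\<Sum>j<n. (cmod (T $$ (l, j)))\<^sup>2)"
      using T l by (intro sum.cong) auto
    also have "(\<Sum>i<n. e i * (cmod (W $$ (i, l)))\<^sup>2) = (\<Sum>i<k. (cmod (W $$ (i, l)))\<^sup>2)"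
      using k by (intro sum.mono_neutral_cong_right) (auto simp: e_def)
    finally show ?thesis .
  qed
  have "(\<Sum>j<n. z j powr s) \<le> (\<Sum>j<n. \<Sum>l<n. (cmod (T $$ (l, j)))\<^sup>2 * c l powr s)"
  proof (rule sum_mono)
    fix j assume "j \<in> {..<n}"
    then have j: "j < n" by simp
    show "z j powr s \<le> (\<Sum>l<n. (cmod (T $$ (l, j)))\<^sup>2 * c l powr s)"
      unfolding z_eq[OF j] by (rule powr_weighted_sum_le[OF s _ c0 col[OF j]]) auto
  qed
  also have "\<dots> = (\<Sum>l<n. (\<Sum>j<n. (cmod (T $$ (l, j)))\<^sup>2) * c l powr s)"
    by (subst sum.swap) (simp only: sum_distrib_right)
  also have "\<dots> = (\<Sum>l<n. (\<Sum>i<k. (cmod (W $$ (i, l)))\<^sup>2) * c l powr s)"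
    by (intro sum.cong) (auto simp: row)
  also have "\<dots> = (\<Sum>i<k. \<Sum>l<n. (cmod (W $$ (i, l)))\<^sup>2 * c l powr s)"
    by (simp only: sum_distrib_right) (rule sum.swap)
  finally show ?thesis .
qed

lemma qform_rdiag_conj_nonneg:
  assumes A: "A \<in> carrier_mat n n" and psd: "\<And>x. x \<in> carrier_vec n \<Longrightarrow> 0 \<le> qform A x"
    and x: "x \<in> carrier_vec n"
  shows "0 \<le> qform (rdiag n d * A * rdiag n d) x"
  using qform_conj[of "rdiag n d" n n A x] A x psd[of "rdiag n d *\<^sub>v x"]
  by (simp add: mult_mat_vec_carrier[of _ n n])

text \<open>The trace inequality in an eigenbasis of \<open>B\<close>, where \<open>B = diag b\<close>, with \<open>B^r\<close> replaced by
  \<open>diag g\<close>.  The inner sum on the right is the \<open>i\<close>-th diagonal entry of \<open>C^s\<close>, where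
  \<open>C = B^(1/2) A B^(1/2)\<close>.\<close>

lemma weighted_trace_ge:
  assumes U: "diagonalizes n U a A" and a_dec: "\<And>i j. i \<le> j \<Longrightarrow> j < n \<Longrightarrow> a j \<le> a i"
    and psd: "\<And>x. x \<in> carrier_vec n \<Longrightarrow> 0 \<le> qform A x"
    and b0: "\<And>i. i < n \<Longrightarrow> 0 \<le> b i" and b_dec: "\<And>i j. i \<le> j \<Longrightarrow> j < n \<Longrightarrow> b j \<le> b i"
    and W: "diagonalizes n W c (rdiag n (\<lambda>i. sqrt (b i)) * A * rdiag n (\<lambda>i. sqrt (b i)))"
    and g0: "\<And>i. i < n \<Longrightarrow> 0 \<le> g i" and g_dec: "\<And>i. Suc i < n \<Longrightarrow> g (Suc i) \<le> g i"
    and s: "s \<ge> 1"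
  shows "(\<Sum>i<n. g i * (a (n - Suc i) * b i) powr s) \<le>
    (\<Sum>i<n. g i * (\<Sum>l<n. (cmod (W $$ (i, l)))\<^sup>2 * c l powr s))"
proof (rule sum_mult_mono_of_partial_sums[where g = g])
  note u = diagonalizesD[OF U]
  have c0: "0 \<le> c i" if "i < n" for i
    by (rule eigenvalue_nonneg[OF W qform_rdiag_conj_nonneg[OF u(5) psd] that])
  fix k assume k: "k \<le> n"
  define e :: "nat \<Rightarrow> real" where "e i = (if i < k then 1 else 0)" for i
  define b' where "b' i = (if i < k then b i else 0)" for i
  let ?D = "rdiag n (\<lambda>i. sqrt (b' i))" and ?S = "rdiag n (\<lambda>i. sqrt (b i))"
  have D: "rdiag n e * ?S = ?D" "?S * rdiag n e = ?D"
    by (simp_all, intro eq_matI; auto simp: mat_diag_def e_def b'_def)+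
  have "rdiag n e * (?S * A * ?S) * rdiag n e = (rdiag n e * ?S) * A * (?S * rdiag n e)"
    using u(5) by (simp add: square_mat_simps[where n = n] del: mat_diag_diag)
  then have compress: "rdiag n e * (?S * A * ?S) * rdiag n e = ?D * A * ?D" unfolding D .
  have DAD: "?D * A * ?D \<in> carrier_mat n n"
    using u(5) by (simp add: square_mat_simps[where n = n])
  have herm: "mat_adjoint (?D * A * ?D) = ?D * A * ?D"
    using u(5,7) by (simp add: square_mat_simps[where n = n])
  obtain Z z where Z: "diagonalizes n Z z (?D * A * ?D)"
    by (rule hermitian_diagonalization[OF DAD herm]) (rule that)
  have z0: "0 \<le> z i" if "i < n" for i
    by (rule eigenvalue_nonneg[OF Z qform_rdiag_conj_nonneg[OF u(5) psd] that])
  have b'0: "0 \<le> b' i" if "i < n" for i using b0[OF that] by (simp add: b'_def)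
  have b'_dec: "b' j \<le> b' i" if "i \<le> j" "j < n" for i j
    using b_dec[OF that] b0[of i] that by (auto simp: b'_def)
  have s0: "s > 0" using s by simp
  have "(\<Sum>i<k. (a (n - Suc i) * b i) powr s) = (\<Sum>i<n. (a (n - Suc i) * b' i) powr s)"
    using k by (intro sum.mono_neutral_cong_left) (auto simp: b'_def)
  also have "\<dots> = (\<Sum>i<n. (a (n - Suc (n - Suc i)) * b' (n - Suc i)) powr s)"
    by (rule sum.nat_diff_reindex[symmetric])
  also have "\<dots> = (\<Sum>i<n. (a i * b' (n - Suc i)) powr s)"
    by (intro sum.cong) auto
  also have "\<dots> \<le> (\<Sum>i<n. z i powr s)"
    by (rule sum_powr_eigenvalues_product_ge[OF U a_dec psd b'0 b'_dec Z z0 s0])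
  also have "\<dots> \<le> (\<Sum>i<k. \<Sum>l<n. (cmod (W $$ (i, l)))\<^sup>2 * c l powr s)"
  proof -
    have Z': "diagonalizes n Z z (rdiag n (\<lambda>i. if i < k then 1 else 0) * (?S * A * ?S)
        * rdiag n (\<lambda>i. if i < k then 1 else 0))"
      using Z unfolding compress[symmetric] e_def .
    show ?thesis using sum_powr_compression_le[OF W c0 k s Z'] .
  qed
  finally show "(\<Sum>i<k. (a (n - Suc i) * b i) powr s)
    \<le> (\<Sum>i<k. \<Sum>l<n. (cmod (W $$ (i, l)))\<^sup>2 * c l powr s)" .
qed (use g0 g_dec in auto)

section \<open>The trace inequality\<close>

lemma mtrace_mult_commute:
  fixes X Y :: "complex mat"
  assumes "X \<in> carrier_mat n n" "Y \<in> carrier_mat n n"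
  shows "mtrace (X * Y) = mtrace (Y * X)"
proof -
  have "mtrace (X * Y) = (\<Sum>i<n. \<Sum>l<n. X $$ (i, l) * Y $$ (l, i))"
    unfolding mtrace_def using assms by (intro sum.cong) (auto simp del: index_mult_mat(1) intro!: mult_mat_index_sum[of _ n n _ n])
  also have "\<dots> = (\<Sum>l<n. \<Sum>i<n. Y $$ (l, i) * X $$ (i, l))"
    by (subst sum.swap) (simp only: mult.commute)
  also have "\<dots> = mtrace (Y * X)"
    unfolding mtrace_def using assms by (intro sum.cong) (auto simp del: index_mult_mat(1) intro!: mult_mat_index_sum[of _ n n _ n, symmetric])
  finally show ?thesis .
qed

text \<open>For a positive semidefinite matrix \<open>|A| = A\<close>, so its singular values are its eigenvalues.\<close>

lemma singular_values_psd:
  assumes U: "diagonalizes n U a A" and a_dec: "\<And>i j. i \<le> j \<Longrightarrow> j < n \<Longrightarrow> a j \<le> a i"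
    and a0: "\<And>i. i < n \<Longrightarrow> 0 \<le> a i"
  shows "singular_values A = map a [0..<n]"
proof -
  note u = diagonalizesD[OF U]
  note [simp] = square_mat_simps[where n = n] u(1,2,3,6) left_unitary_cancel[OF u(2)]
  have dd: "rdiag n a * (rdiag n a * mat_adjoint U) = rdiag n (\<lambda>i. (a i)\<^sup>2) * mat_adjoint U"
    by (simp flip: assoc_mult_mat[of "rdiag n a" n n "rdiag n a" n "mat_adjoint U" n] add: power2_eq_square)
  have "mat_adjoint A * A = (U * rdiag n a * mat_adjoint U) * (U * rdiag n a * mat_adjoint U)"
    unfolding u(7) using u(4) by simp
  also have "\<dots> = U * rdiag n (\<lambda>i. (a i)\<^sup>2) * mat_adjoint U" by (simp add: dd)
  finally have "diagonalizes n U (\<lambda>i. (a i)\<^sup>2) (mat_adjoint A * A)"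
    unfolding diagonalizes_def using u(1-3) by simp
  from diagonalizes_mat_powr[OF this, of "1 / 2"]
  have "diagonalizes n U (\<lambda>i. ((a i)\<^sup>2) powr (1 / 2)) (mat_abs A)"
    unfolding mat_abs_def by simp
  then have cp: "char_poly (mat_abs A) = (\<Prod>x\<leftarrow>map (\<lambda>i. complex_of_real (((a i)\<^sup>2) powr (1 / 2))) [0..<n]. [:- x, 1:])"
    by (rule char_poly_diagonalizes)
  have "map (\<lambda>i. complex_of_real (((a i)\<^sup>2) powr (1 / 2))) [0..<n] = map (\<lambda>i. complex_of_real (a i)) [0..<n]"
    using a0 by (auto simp: powr_half_sqrt)
  note cp = cp[unfolded this]
  have roots: "proots (\<Prod>x\<leftarrow>xs. [:- x, 1:]) = mset xs" for xs :: "complex list"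
  proof (induction xs)
    case (Cons x xs)
    have "(\<Prod>y\<leftarrow>xs. [:- y, 1:]) \<noteq> 0" by (auto simp: prod_list_zero_iff)
    then have "proots ([:- x, 1:] * (\<Prod>y\<leftarrow>xs. [:- y, 1:])) = {#x#} + mset xs"
      by (subst proots_mult) (auto simp: Cons.IH)
    then show ?case by (simp only: list.map prod_list.Cons mset.simps) simp
  qed simp
  have "image_mset Re (proots (char_poly (mat_abs A))) = mset (map a [0..<n])"
    unfolding cp roots by (simp flip: mset_map add: o_def)
  then have "singular_values A = rev (sort (map a [0..<n]))"
    unfolding singular_values_def by (simp only: sorted_list_of_multiset_mset)
  also have "sort (map a [0..<n]) = rev (map a [0..<n])"
  proof (rule properties_for_sort)
    show "sorted (rev (map a [0..<n]))"
      unfolding sorted_iff_nth_mono using a_dec by (auto simp: rev_nth simp del: upt_conv_Cons)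
  qed simp
  finally show ?thesis by simp
qed

lemma positive_semidefinite_diagonalization:
  assumes A: "A \<in> carrier_mat n n" and psd: "positive_semidefinite A"
  obtains U a where "diagonalizes n U a A" "\<And>i j. i \<le> j \<Longrightarrow> j < n \<Longrightarrow> a j \<le> a i"
    "\<And>i. i < n \<Longrightarrow> 0 \<le> a i"
proof -
  have "mat_adjoint A = A" using psd unfolding positive_semidefinite_def by simp
  then obtain U a where U: "diagonalizes n U a A" "\<And>i j. i \<le> j \<Longrightarrow> j < n \<Longrightarrow> a j \<le> a i"
    using hermitian_diagonalization[OF A] by blast
  have "0 \<le> a i" if "i < n" for i
    by (rule eigenvalue_nonneg[OF U(1) positive_semidefinite_qform[OF psd A] that])
  with U that show ?thesis by blast
qed

theorem theorem3p1:
  fixes A B :: "complex mat" and n :: nat and r s :: real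
  assumes "A \<in> carrier_mat n n" and "B \<in> carrier_mat n n"
    and "positive_semidefinite A" and "positive_semidefinite B"
    and "r \<ge> 0" and "s \<ge> 1"
  shows "mtrace (mat_powr B r *
            mat_powr (mat_powr B (1 / 2) * A * mat_powr B (1 / 2)) s)
         \<ge> mtrace (mat_powr (Sigma_up A) s * mat_powr (Sigma_down B) (s + r))"
proof -
  obtain U a where U: "diagonalizes n U a A" and a_dec: "\<And>i j. i \<le> j \<Longrightarrow> j < n \<Longrightarrow> a j \<le> a i"
    and a0: "\<And>i. i < n \<Longrightarrow> 0 \<le> a i"
    using positive_semidefinite_diagonalization[OF assms(1,3)] by blast
  obtain V b where V: "diagonalizes n V b B" and b_dec: "\<And>i j. i \<le> j \<Longrightarrow> j < n \<Longrightarrow> b j \<le> b i"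
    and b0: "\<And>i. i < n \<Longrightarrow> 0 \<le> b i"
    using positive_semidefinite_diagonalization[OF assms(2,4)] by blast
  note u = diagonalizesD[OF U] and v = diagonalizesD[OF V]
  note [simp] = square_mat_simps[where n = n] u(1,2,3,5,6) v(1,2,3,5,6)
    left_unitary_cancel[OF u(2)] left_unitary_cancel[OF u(3)]
    left_unitary_cancel[OF v(2)] left_unitary_cancel[OF v(3)]
  \<comment> \<open>The case distinction reproduces the convention \<open>B^0 = I\<close> for singular \<open>B\<close>.\<close>
  define g where "g i = (if r = 0 then 1 else b i powr r)" for i
  define S where "S = rdiag n (\<lambda>i. sqrt (b i))"
  define A0 where "A0 = mat_adjoint V * A * V"
  have S: "S \<in> carrier_mat n n" "mat_adjoint S = S" unfolding S_def by simp_all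
  have A0: "A0 \<in> carrier_mat n n" unfolding A0_def by simp
  note [simp] = S A0
  \<comment> \<open>Everything is conjugated by \<open>V\<close>: \<open>A0\<close> is \<open>A\<close> and \<open>S\<close> is \<open>B^(1/2)\<close>, written in the eigenbasis of \<open>B\<close>.\<close>
  have A0d: "diagonalizes n (mat_adjoint V * U) a A0"
    unfolding diagonalizes_def A0_def by (subst u(4)) simp
  have psd0: "0 \<le> qform A0 x" if x: "x \<in> carrier_vec n" for x
    using qform_conj[of "mat_adjoint V" n n A x] positive_semidefinite_qform[OF assms(3,1), of "V *\<^sub>v x"] x
    unfolding A0_def by simp
  have C0: "S * A0 * S \<in> carrier_mat n n" by simp
  have C0_herm: "mat_adjoint (S * A0 * S) = S * A0 * S" using diagonalizesD(7)[OF A0d] by simp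
  obtain W c where W: "diagonalizes n W c (S * A0 * S)"
    by (rule hermitian_diagonalization[OF C0 C0_herm]) (rule that)
  note w = diagonalizesD[OF W]
  note [simp] = w(1,2,3,6) left_unitary_cancel[OF w(2)] left_unitary_cancel[OF w(3)]
  have s0: "s \<noteq> 0" "s + r \<noteq> 0" using assms(5,6) by auto
  have "rdiag n (\<lambda>i. if (1::real) / 2 = 0 then 1 else b i powr (1 / 2)) = S"
    unfolding S_def using b0 by (intro eq_matI) (auto simp: mat_diag_def powr_half_sqrt)
  then have half: "mat_powr B (1 / 2) = V * S * mat_adjoint V"
    using diagonalizesD(4)[OF diagonalizes_mat_powr[OF V, of "1 / 2"]] by simp
  have "mat_powr B (1 / 2) * A * mat_powr B (1 / 2) = V * (S * A0 * S) * mat_adjoint V"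
    unfolding half A0_def by simp
  also have "\<dots> = (V * W) * rdiag n c * mat_adjoint (V * W)"
    unfolding w(4) by simp
  finally have "diagonalizes n (V * W) c (mat_powr B (1 / 2) * A * mat_powr B (1 / 2))"
    unfolding diagonalizes_def by simp
  from diagonalizesD(4)[OF diagonalizes_mat_powr[OF this, of s]]
  have Cs: "mat_powr (mat_powr B (1 / 2) * A * mat_powr B (1 / 2)) s
      = V * (W * rdiag n (\<lambda>i. c i powr s) * mat_adjoint W) * mat_adjoint V"
    using s0 by simp
  have Br: "mat_powr B r = V * rdiag n g * mat_adjoint V"
    using diagonalizesD(4)[OF diagonalizes_mat_powr[OF V, of r]] unfolding g_def .
  define H where "H = mat_adjoint (mat_adjoint W) * (rdiag n (\<lambda>i. c i powr s) * mat_adjoint W)"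
  have H: "H \<in> carrier_mat n n" unfolding H_def by simp
  note [simp] = H
  have "mtrace (mat_powr B r * mat_powr (mat_powr B (1 / 2) * A * mat_powr B (1 / 2)) s)
      = mtrace (V * (rdiag n g * H * mat_adjoint V))"
    unfolding Br Cs H_def by simp
  also have "\<dots> = mtrace (rdiag n g * H)"
    by (subst mtrace_mult_commute[of _ n]) simp_all
  also have "\<dots> = complex_of_real (\<Sum>i<n. g i * (\<Sum>l<n. (cmod (W $$ (i, l)))\<^sup>2 * c l powr s))"
  proof -
    have entry: "(rdiag n g * H) $$ (i, i) = complex_of_real (g i * (\<Sum>l<n. (cmod (W $$ (i, l)))\<^sup>2 * c l powr s))"
      if i: "i < n" for i
    proof -
      have "H $$ (i, i) = complex_of_real (\<Sum>l<n. c l powr s * (cmod (mat_adjoint W $$ (l, i)))\<^sup>2)"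
        unfolding H_def by (rule diag_entry_adjoint_conj[OF w(6) i])
      also have "(\<Sum>l<n. c l powr s * (cmod (mat_adjoint W $$ (l, i)))\<^sup>2) = (\<Sum>l<n. (cmod (W $$ (i, l)))\<^sup>2 * c l powr s)"
        using carrier_matD[OF w(1)] i by (intro sum.cong) auto
      finally show ?thesis using i by (simp add: mat_diag_mult_left[OF H])
    qed
    have "mtrace (rdiag n g * H) = (\<Sum>i<n. (rdiag n g * H) $$ (i, i))"
      unfolding mtrace_def by (intro sum.cong) (simp_all add: mat_diag_def)
    also have "\<dots> = (\<Sum>i<n. complex_of_real (g i * (\<Sum>l<n. (cmod (W $$ (i, l)))\<^sup>2 * c l powr s)))"
      by (intro sum.cong refl entry) simp
    finally show ?thesis by (simp only: of_real_sum)
  qed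
  finally have lhs: "mtrace (mat_powr B r * mat_powr (mat_powr B (1 / 2) * A * mat_powr B (1 / 2)) s)
    = complex_of_real (\<Sum>i<n. g i * (\<Sum>l<n. (cmod (W $$ (i, l)))\<^sup>2 * c l powr s))" .
  have sv: "singular_values A = map a [0..<n]" "singular_values B = map b [0..<n]"
    by (rule singular_values_psd[OF U a_dec a0], assumption+)
      (rule singular_values_psd[OF V b_dec b0], assumption+)
  have "Sigma_up A = rdiag n a"
    unfolding Sigma_up_def sv carrier_matD(1)[OF u(5)]
    by (intro eq_matI) (auto simp: mat_diag_def)
  moreover have "Sigma_down B = rdiag n (\<lambda>i. b (n - Suc i))"
    unfolding Sigma_down_def sv carrier_matD(1)[OF v(5)]
    by (intro eq_matI) (auto simp: mat_diag_def rev_nth)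
  ultimately have "mtrace (mat_powr (Sigma_up A) s * mat_powr (Sigma_down B) (s + r))
    = complex_of_real (\<Sum>i<n. a i powr s * b (n - Suc i) powr (s + r))"
    using s0 by (simp add: mat_powr_rdiag mtrace_def) (simp add: mat_diag_def)
  \<comment> \<open>The sum is reversed so that it is indexed by the decreasing order of \<open>b\<close>.\<close>
  also have "(\<Sum>i<n. a i powr s * b (n - Suc i) powr (s + r))
      = (\<Sum>i<n. a (n - Suc (n - Suc i)) powr s * b (n - Suc i) powr (s + r))"
    by (intro sum.cong) auto
  also have "\<dots> = (\<Sum>i<n. a (n - Suc i) powr s * b i powr (s + r))"
    by (rule sum.nat_diff_reindex)
  also have "\<dots> = (\<Sum>i<n. g i * (a (n - Suc i) * b i) powr s)"
    using a0 b0 by (intro sum.cong) (auto simp: g_def powr_mult powr_add)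
  finally have rhs: "mtrace (mat_powr (Sigma_up A) s * mat_powr (Sigma_down B) (s + r))
    = complex_of_real (\<Sum>i<n. g i * (a (n - Suc i) * b i) powr s)" .
  have "(\<Sum>i<n. g i * (a (n - Suc i) * b i) powr s)
     \<le> (\<Sum>i<n. g i * (\<Sum>l<n. (cmod (W $$ (i, l)))\<^sup>2 * c l powr s))"
  proof (rule weighted_trace_ge[OF A0d a_dec psd0 b0 b_dec _ _ _ assms(6)])
    show "diagonalizes n W c (rdiag n (\<lambda>i. sqrt (b i)) * A0 * rdiag n (\<lambda>i. sqrt (b i)))"
      using W unfolding S_def .
    show "0 \<le> g i" if "i < n" for i unfolding g_def by simp
    show "g (Suc i) \<le> g i" if "Suc i < n" for i
      using b_dec[of i "Suc i"] b0[of "Suc i"] that assms(5) by (auto simp: g_def intro!: powr_mono2)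
  qed
  then show ?thesis unfolding lhs rhs by (simp only: less_eq_complex_def Re_complex_of_real Im_complex_of_real simp_thms)
qed

end
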